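(* Suppose that the loss assumptions (1)–(5) listed in the context hold and that node $u$ is removed, turning $\mathcal D=(X,Y,A)$ into $\mathcal D'=(X',Y',A')$. If $\|\hat Ze_j-Ze_j\|\le\epsilon_1$ for all $j\in[F]$, then the unlearned model $w^-=w^\star+\hat H_{w^\star}^{-1}\Delta$ satisfies $$\|\nabla\mathcal L(w^-,\mathcal D')\|\le\frac{4c\gamma_1F}{\lambda(n_t-1)}+\left(\frac{c\gamma_1}{\lambda}F+c_1\sqrt{F(n_t-1)}\right)\left(\epsilon_1+\frac{2\gamma_1F}{\lambda(n_t-1)}\left(2\epsilon_1+4\sqrt{d(u)}+\sum_{w\in\mathcal N(u)}\frac{4}{\sqrt{d(w)}}\right)\right).$$
   Context: Graph and data. $\mathcal G$ is an undirected graph on $n$ nodes; $A$ and $D$ are its adjacency matrix and diagonal degree matrix with self-loops; $d(u)=D_{uu}$ and $\mathcal N(u)=\{t: A_{ut}\neq0\}$ is the set of neighbors of $u$. $X\in\mathbb R^{n\times F}$ is the feature matrix, $Y$ the vector of (binary) labels, and $e_i,e_j$ are standard basis vectors. A dataset is $\mathcal D=(X,Y,A)$. The first $n_t$ nodes form the training set. Each column $x=Xe_j$ (a signal vector) is normalized so that $\|D^{1/2}x\|_1\le 1$. Embeddings. Fix $L$ and weights $w_0,\dots,w_L\in\mathbb R$ with $\sum_{\ell=0}^L|w_\ell|\le1$. The exact embedding matrix of $\mathcal D$ is $Z=\sum_{\ell=0}^L w_\ell(D^{-1/2}AD^{-1/2})^\ell X$, and $\hat Z\in\mathbb R^{n\times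 F}$ is an approximation of $Z$. A prime denotes the corresponding quantity for the dataset after removal: $Z'$ is the exact embedding matrix computed from $X'$, $A'$ and its degree matrix $D'$ (with the convention $0^{-1/2}=0$), and $\hat Z'$ is its approximation. The approximations $\hat Z$ and $\hat Z'$ are produced, column by column, by a local push procedure with a threshold $r_{\max}$: for each signal vector $x$ one keeps reserve vectors $q^{(\ell)}$ and residue vectors $r^{(\ell)}$, $0\le\ell\le L$, starting from $r^{(0)}=D^{1/2}x$ and all others zero; whenever $|r^{(\ell)}(v)|>r_{\max}$ with $\ell<L$, the value $r^{(\ell)}(v)/d(v)$ is added to $r^{(\ell+1)}(t)$ for all $t\in\mathcal N(v)$, $r^{(\ell)}(v)$ is added to $q^{(\ell)}(v)$, and $r^{(\ell)}(v)$ is set to $0$; at the end $r^{(L)}$ is moved into $q^{(L)}$; the approximate column is $\sum_\ell w_\ell D^{-1/2}q^{(\ell)}$. After a removal the residues of the affected nodes are adjusted and the same push procedure with the same $r_{\max}$ is run on the new graph, giving $\hat Z'$. Every column output by this procedure, before or after a removal, has Euclidean error at most $\sqrt n\,L\,r_{\max}$, and this is the value taken by $\epsilon_1$. Node unlearning. $X',Y',A'$ equal $X,Y,A$ except that all entries regarding the removed node $u$ (its row in $X$ and $Y$, its row and column in $A$) are set to zero. The training nodes of $\mathcal D'$ are those of $\mathcal D$ other than $u$. Loss. $\ell(\cdot,y)$ is a convex loss (in its first argument), differentiable everywhere; $\ell',\ell''$ denote derivatives in the first argument. For $\lambda>0$, $\mathcal L(w,\mathcal D)=\sum_{i}\left(\ell(e_i^\top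 Zw,e_i^\top Y)+\frac\lambda2\|w\|^2\right)$, the sum being over the training nodes of $\mathcal D$, and $\mathcal L(w,\hat{\mathcal D})$ is the same with $\hat Z$ in place of $Z$; likewise $\mathcal L(w,\mathcal D')$ and $\mathcal L(w,\hat{\mathcal D}')$ use $Z'$ and $\hat Z'$, the labels $Y'$ and the training nodes of $\mathcal D'$. Gradients are with respect to $w\in\mathbb R^F$. Unlearning mechanism. $w^\star$ is the unique minimizer of $\mathcal L(\cdot,\hat{\mathcal D})$, $\Delta=\nabla\mathcal L(w^\star,\hat{\mathcal D})-\nabla\mathcal L(w^\star,\hat{\mathcal D}')$, $\hat H_{w^\star}=\nabla^2\mathcal L(w^\star,\hat{\mathcal D}')$, and $w^-=w^\star+\hat H_{w^\star}^{-1}\Delta$. Loss assumptions. For any dataset $\mathcal D$, $i\in[n]$ and $w\in\mathbb R^F$: (1) $\|\nabla\ell(e_i^\top Zw,e_i^\top Y)\|\le c$; (2) $\ell'$ is $c_1$-bounded; (3) $\ell'$ is $\gamma_1$-Lipschitz; (4) $\ell''$ is $\gamma_2$-Lipschitz; (5) $\|e_i^\top X\|\le1$. $\|\cdot\|$ is the Euclidean norm for vectors and the spectral norm for matrices.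
   Formalization: The removed node u is assumed to be a training node (and n_t ≥ 2); for a non-training u the stated bound with n_t−1 can fail, e.g. for isolated nodes, a linear loss, and features exactly at the push threshold. *)

theory Defs
  imports "HOL-Analysis.Analysis"
begin

text \<open>Nodes are indexed by \<^typ>\<open>'n\<close> and features by \<^typ>\<open>'f\<close>; \<open>real ^ 'f ^ 'n\<close> is the type of
  matrices with \<open>CARD('n)\<close> rows and \<open>CARD('f)\<close> columns.\<close>

record ('n, 'f) dataset =
  feat :: "real ^ 'f::finite ^ 'n::finite"
  lab :: "real ^ 'n"
  adj :: "real ^ 'n ^ 'n"

definition undirected_self_loops :: "real ^ 'n ^ 'n \<Rightarrow> bool" where
  "undirected_self_loops A \<longleftrightarrow>
     (\<forall>i j. A $ i $ j \<in> {0, 1}) \<and> (\<forall>i j. A $ i $ j = A $ j $ i) \<and> (\<forall>i. A $ i $ i = 1)"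

definition deg :: "real ^ 'n ^ 'n \<Rightarrow> 'n \<Rightarrow> real" where
  "deg A u = (\<Sum>t\<in>UNIV. A $ u $ t)"

definition nbrs :: "real ^ 'n ^ 'n \<Rightarrow> 'n \<Rightarrow> 'n set" where
  "nbrs A u = {t. A $ u $ t \<noteq> 0}"

text \<open>The power \<open>D\<^sup>p\<close> of the diagonal degree matrix. As \<open>0 powr p = 0\<close>, this follows the
  convention that \<open>0\<close> to the power \<open>-1/2\<close> is \<open>0\<close>.\<close>

definition deg_pow :: "real ^ 'n ^ 'n \<Rightarrow> real \<Rightarrow> real ^ 'n ^ 'n" where
  "deg_pow A p = (\<chi> i j. if i = j then deg A i powr p else 0)"

definition prop_matrix :: "real ^ 'n ^ 'n \<Rightarrow> real ^ 'n ^ 'n" where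
  "prop_matrix A = deg_pow A (-1/2) ** A ** deg_pow A (-1/2)"

text \<open>Matrix powers are iterated \<open>**\<close>: the operation \<open>^\<close> on \<open>real ^ 'n ^ 'n\<close> acts entrywise.\<close>

definition embedding :: "nat \<Rightarrow> (nat \<Rightarrow> real) \<Rightarrow> ('n::finite, 'f::finite) dataset \<Rightarrow> real ^ 'f ^ 'n" where
  "embedding L wt \<D> = (\<Sum>l\<le>L. wt l *\<^sub>R (((**) (prop_matrix (adj \<D>)) ^^ l) (feat \<D>)))"

definition remove_node :: "'n \<Rightarrow> ('n::finite, 'f::finite) dataset \<Rightarrow> ('n, 'f) dataset" where
  "remove_node u \<D> =
     \<lparr>feat = (\<chi> i. if i = u then 0 else feat \<D> $ i),
      lab = (\<chi> i. if i = u then 0 else lab \<D> $ i),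
      adj = (\<chi> i j. if i = u \<or> j = u then 0 else adj \<D> $ i $ j)\<rparr>"

text \<open>Local push: a state consists of the reserves \<open>q l\<close> and the residues \<open>r l\<close> for the levels
  \<open>l \<le> L\<close>. The order in which the entries exceeding the threshold are pushed is arbitrary.\<close>

type_synonym 'n push_state = "(nat \<Rightarrow> real ^ 'n) \<times> (nat \<Rightarrow> real ^ 'n)"

inductive push_step ::
    "real ^ 'n ^ 'n \<Rightarrow> nat \<Rightarrow> real \<Rightarrow> 'n push_state \<Rightarrow> 'n push_state \<Rightarrow> bool"
  for A :: "real ^ 'n ^ 'n" and L :: nat and rmax :: real where
  "\<lbrakk>l < L; \<bar>r l $ v\<bar> > rmax\<rbrakk> \<Longrightarrow>
   push_step A L rmax (q, r)
     (q(l := q l + axis v (r l $ v)),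
      r(l := r l - axis v (r l $ v),
        Suc l := r (Suc l) + (\<chi> t. if t \<in> nbrs A v then r l $ v / deg A v else 0)))"

definition push_run ::
    "real ^ 'n ^ 'n \<Rightarrow> nat \<Rightarrow> real \<Rightarrow> 'n push_state \<Rightarrow> 'n push_state \<Rightarrow> bool" where
  "push_run A L rmax s s' \<longleftrightarrow>
     (\<exists>q r. (push_step A L rmax)\<^sup>*\<^sup>* s (q, r) \<and> (\<forall>l<L. \<forall>v. \<bar>r l $ v\<bar> \<le> rmax) \<and>
            s' = (q(L := q L + r L), r(L := 0)))"

definition init_state :: "real ^ 'n ^ 'n \<Rightarrow> real ^ 'n \<Rightarrow> 'n push_state" where
  "init_state A x = ((\<lambda>_. 0), (\<lambda>_. 0)(0 := deg_pow A (1/2) *v x))"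

text \<open>Every state (\<open>q\<close>, \<open>r\<close>) reachable from \<^const>\<open>init_state\<close> by pushing on the graph \<open>A\<close> with
  degree matrix \<open>D\<close> satisfies \<open>q 0 + r 0 = D\<^bsup>1/2\<^esup> x\<close> and \<open>q (l+1) + r (l+1) = A D\<^bsup>-1\<^esup> (q l)\<close>
  (\<open>l < L\<close>). After a
  change of the dataset the reserves are kept and the residues are reset to the values for which
  these equations hold for the new dataset; this only changes residues of nodes for which an
  equation has changed.\<close>

definition adjust_state :: "real ^ 'n ^ 'n \<Rightarrow> real ^ 'n \<Rightarrow> 'n push_state \<Rightarrow> 'n push_state" where
  "adjust_state A x s =
     (fst s,
      \<lambda>l. case l of
            0 \<Rightarrow> deg_pow A (1/2) *v x - fst s 0
          | Suc k \<Rightarrow> A *v (deg_pow A (-1) *v fst s k) - fst s (Suc k))"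

definition push_output ::
    "real ^ 'n ^ 'n \<Rightarrow> nat \<Rightarrow> (nat \<Rightarrow> real) \<Rightarrow> 'n push_state \<Rightarrow> real ^ 'n" where
  "push_output A L wt s = (\<Sum>l\<le>L. wt l *\<^sub>R (deg_pow A (-1/2) *v fst s l))"

definition grad :: "(real ^ 'f \<Rightarrow> real) \<Rightarrow> real ^ 'f \<Rightarrow> real ^ 'f" where
  "grad f w = (THE g. GDERIV f w :> g)"

definition hessian :: "(real ^ 'f \<Rightarrow> real) \<Rightarrow> real ^ 'f \<Rightarrow> real ^ 'f ^ 'f" where
  "hessian f w = jacobian (grad f) (at w)"

definition total_loss ::
    "(real \<Rightarrow> real \<Rightarrow> real) \<Rightarrow> real \<Rightarrow> 'n set \<Rightarrow> real ^ 'f ^ 'n \<Rightarrow> real ^ 'n \<Rightarrow> real ^ 'f \<Rightarrow> real"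
  where
  "total_loss loss lam T Z Y w = (\<Sum>i\<in>T. loss ((Z *v w) $ i) (Y $ i) + lam / 2 * (norm w)\<^sup>2)"

abbreviation dloss :: "(real \<Rightarrow> real \<Rightarrow> real) \<Rightarrow> real \<Rightarrow> real \<Rightarrow> real" where
  "dloss loss y \<equiv> deriv (\<lambda>z. loss z y)"

end

theory Submission
  imports Defs
begin

text \<open>
  Only the error bound \<open>\<epsilon>\<^sub>1\<close> of the push procedure after the removal matters, not the distance of the
  embeddings before and after it. An invariant of the push steps together with the contractivity of
  \<open>D\<^bsup>-1/2\<^esup> A D\<^bsup>-1/2\<^esup>\<close> bounds the column errors of \<open>Zh'\<close> by \<open>\<epsilon>\<^sub>1\<close>. As pushes never create
  \<open>l\<^sup>1\<close> mass, the columns of \<open>Zh\<close> are bounded by \<open>1\<close>; the columns of the exact embedding are bounded by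
  \<open>1\<close> as well. Put \<open>m = n\<^sub>t - 1\<close> and \<open>\<kappa> = c\<^sub>1 \<surd>(F m)\<close>. Stationarity of \<open>wstar\<close> yields
  \<open>\<lambda> m \<parallel>wstar\<parallel> \<le> \<kappa>\<close>, so one Newton step for the approximate objective leaves an exact gradient of norm
  at most \<open>\<kappa> (\<epsilon>\<^sub>1 + \<gamma>\<^sub>1 F / (\<lambda> m) (4 \<epsilon>\<^sub>1 + 16))\<close>. The claimed bound is larger because every degree
  is at least \<open>1\<close> and \<open>u\<close> is its own neighbor, whence
  \<open>4 \<surd>d(u) + \<Sum>\<^bsub>v \<in> N(u)\<^esub> 4 / \<surd>d(v) \<ge> 4 \<surd>d(u) + 4 / \<surd>d(u) \<ge> 8\<close>.
\<close>

subsection \<open>Matrices and regularized linear equations\<close>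

text \<open>Pairing the equation with \<open>x\<close> drops the \<open>N\<close> term by
  positivity, and Cauchy-Schwarz finishes. This replaces spectral bounds on the inverse of the
  Hessian.\<close>

lemma norm_le_of_regularized_eq:
  fixes N :: "'a::real_inner \<Rightarrow> 'a"
  assumes psd: "inner x (N x) \<ge> 0" and eq: "\<mu> *\<^sub>R x + N x = y"
  shows "\<mu> * norm x \<le> norm y"
proof (cases "x = 0")
  case False
  have "\<mu> * (norm x * norm x) \<le> inner x y"
    using psd by (simp add: eq[symmetric] inner_add_right dot_square_norm power2_eq_square)
  also have "\<dots> \<le> norm x * norm y"
    by (rule norm_cauchy_schwarz)
  finally show ?thesis
    using False by (simp add: mult.left_commute mult.commute)
qed simp

text \<open>After pairing with \<open>x\<close>, the mixed term in \<open>x\<close> and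
  \<open>N q\<close> is split by the arithmetic-geometric mean inequality for the form of
  \<open>N\<close>, so the quadratic term in \<open>x\<close> cancels.\<close>

lemma norm_square_le_of_regularized_eq:
  fixes N :: "'a::real_inner \<Rightarrow> 'a"
  assumes lin: "linear N" and sym: "\<And>x y. inner x (N y) = inner y (N x)"
    and psd: "\<And>x. inner x (N x) \<ge> 0" and bound: "\<And>x. norm (N x) \<le> \<nu> * norm x"
    and mu: "\<mu> > 0" and eq: "\<mu> *\<^sub>R x + N x = \<mu> *\<^sub>R p + N q"
  shows "\<mu> * (norm x)\<^sup>2 \<le> \<mu> * (norm p * norm x) + \<nu> * (norm q)\<^sup>2 / 4"
proof -
  \<comment> \<open>The factor 1/2 makes the coefficient of \<open>inner x (N x)\<close> exactly
    one, as on the left of the paired equation.\<close>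
  have "0 \<le> inner (x - (1/2) *\<^sub>R q) (N (x - (1/2) *\<^sub>R q))"
    by (rule psd)
  also have "\<dots> = inner x (N x) - inner x (N q) + inner q (N q) / 4"
    using sym[of q x]
    by (simp add: linear_diff[OF lin] linear_scale[OF lin] inner_diff_left inner_diff_right
        algebra_simps)
  finally have amgm: "inner x (N q) \<le> inner x (N x) + inner q (N q) / 4" by simp
  have "inner x (\<mu> *\<^sub>R x + N x) = inner x (\<mu> *\<^sub>R p + N q)"
    by (simp only: eq)
  then have "\<mu> * (norm x)\<^sup>2 + inner x (N x) = \<mu> * inner x p + inner x (N q)"
    by (simp add: inner_add_right dot_square_norm)
  moreover have "\<mu> * inner x p \<le> \<mu> * (norm p * norm x)"
    using mu norm_cauchy_schwarz[of x p] by (simp add: mult.commute)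
  moreover have "inner q (N q) \<le> \<nu> * (norm q)\<^sup>2"
  proof -
    have "inner q (N q) \<le> norm q * norm (N q)" by (rule norm_cauchy_schwarz)
    also have "\<dots> \<le> norm q * (\<nu> * norm q)" by (intro mult_left_mono bound) simp
    finally show ?thesis by (simp add: power2_eq_square algebra_simps)
  qed
  ultimately show ?thesis using amgm by linarith
qed

lemma inner_transpose_mult:
  fixes A :: "real^'f^'n"
  shows "inner x (transpose A *v y) = inner (A *v x) y"
  by (metis dot_lmul_matrix inner_commute transpose_matrix_vector vector_transpose_matrix)

lemma norm_transpose_mult_le:
  fixes A :: "real^'f^'n"
  assumes "\<And>x. norm (A *v x) \<le> b * norm x"
  shows "norm (transpose A *v y) \<le> b * norm y"
proof (cases "transpose A *v y = 0")
  case True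
  show ?thesis
  proof (cases "y = 0")
    case False
    \<comment> \<open>Testing the bound on a unit vector gives the sign of \<open>b\<close>.\<close>
    have "b \<ge> 0"
      using order_trans[OF norm_ge_zero assms[of "axis undefined 1"]] by simp
    then show ?thesis using True by simp
  qed simp
next
  case False
  let ?z = "transpose A *v y"
  have "norm ?z * norm ?z = inner (A *v ?z) y"
    by (metis dot_square_norm inner_transpose_mult power2_eq_square)
  also have "\<dots> \<le> norm (A *v ?z) * norm y"
    by (rule norm_cauchy_schwarz)
  also have "\<dots> \<le> (b * norm ?z) * norm y"
    by (intro mult_right_mono assms) simp
  finally show ?thesis using False by (simp add: mult.commute mult.left_commute)
qed

text \<open>The image is a combination of the columns, and Cauchy-Schwarz against the constant one
  bounds the sum of the coefficients. The factors F of the final bound originate here.\<close>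

lemma norm_matrix_vector_le_columns:
  fixes A :: "real^'f^'n"
  assumes "\<And>j. norm (column j A) \<le> b"
  shows "norm (A *v x) \<le> sqrt (real CARD('f)) * b * norm x"
proof -
  have b: "b \<ge> 0" using order_trans[OF norm_ge_zero assms] .
  have "norm (A *v x) \<le> (\<Sum>j\<in>UNIV. norm ((x$j) *s column j A))"
    unfolding matrix_mult_sum by (rule norm_sum)
  also have "\<dots> \<le> (\<Sum>j\<in>UNIV. \<bar>1\<bar> * \<bar>x$j\<bar> * b)"
    using assms by (intro sum_mono) (simp add: scalar_mult_eq_scaleR mult_left_mono)
  also have "\<dots> = (\<Sum>j\<in>UNIV. \<bar>1\<bar> * \<bar>x$j\<bar>) * b"
    by (simp add: sum_distrib_right)
  also have "\<dots> \<le> (L2_set (\<lambda>_. 1) (UNIV::'f set) * L2_set (\<lambda>j. x$j) UNIV) * b"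
    by (intro mult_right_mono L2_set_mult_ineq b)
  also have "\<dots> = sqrt (real CARD('f)) * b * norm x"
    by (simp add: L2_set_def norm_vec_def)
  finally show ?thesis .
qed

text \<open>Zero padding outside \<open>T\<close> turns sums over the training nodes into a
  transposed matrix applied to a vector of the full type.\<close>

definition supported :: "'n set \<Rightarrow> ('n \<Rightarrow> real) \<Rightarrow> real^'n" where
  "supported T a = (\<chi> i. if i \<in> T then a i else 0)"

lemma norm_supported_le:
  fixes v :: "real^'n"
  assumes "\<And>i. i \<in> T \<Longrightarrow> \<bar>a i\<bar> \<le> k * \<bar>v $ i\<bar>" "k \<ge> 0"
  shows "norm (supported T a) \<le> k * norm v"
proof -
  have "norm (supported T a) \<le> norm (k *\<^sub>R v)"
    by (rule norm_le_componentwise_cart) (use assms in \<open>auto simp: supported_def abs_mult\<close>)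
  then show ?thesis using assms(2) by simp
qed

lemma norm_supported_le_card:
  fixes T :: "'n::finite set"
  assumes "\<And>i. i \<in> T \<Longrightarrow> \<bar>a i\<bar> \<le> k" "k \<ge> 0"
  shows "norm (supported T a) \<le> k * sqrt (real (card T))"
proof -
  have "norm (supported T a) \<le> k * norm (supported T (\<lambda>_. 1))"
    by (rule norm_supported_le) (use assms in \<open>auto simp: supported_def\<close>)
  also have "norm (supported T (\<lambda>_. 1)) = sqrt (real (card T))"
    by (simp add: norm_vec_def L2_set_def supported_def if_distrib[of norm] if_distrib[of "\<lambda>x. x^2"]
        sum.If_cases cong: if_cong)
  finally show ?thesis .
qed

lemma supported_diff: "supported T a - supported T b = supported T (\<lambda>i. a i - b i)"
  by (auto simp: supported_def vec_eq_iff)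

text \<open>Here \<open>\<phi> i\<close> plays the role of \<open>\<ell>'(\<cdot>, y\<^sub>i)\<close>, \<open>d\<close> that of the second derivatives at \<open>Zh w\<close>, and \<open>step\<close>
  says that \<open>s\<close> is the Newton step from \<open>w\<close> for the approximate objective. With
  \<open>p = (Z - Zh)\<^sup>T v Zh w\<close>, \<open>e = Z\<^sup>T (v Z (w + s) - v Zh w)\<close>, \<open>q = \<mu> w + Z\<^sup>T v Z (w + s)\<close> and
  \<open>N = Zh\<^sup>T diag(d) Zh\<close>, the exact gradient \<open>G\<close> at \<open>w + s\<close> solves
  \<open>(\<mu> + N) G = \<mu> (p + e) + N q\<close>. Bounding \<open>N q\<close> directly is cubic in \<open>\<epsilon>\<close>; this is good enough
  only for \<open>\<epsilon> < 1\<close>, while for \<open>\<epsilon> \<ge> 1\<close> pairing with \<open>G\<close> and absorbing \<open>\<langle>G, N q\<rangle>\<close> into \<open>\<langle>G, N G\<rangle>\<close>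
  gives \<open>\<parallel>G\<parallel>\<^sup>2 \<le> \<parallel>p + e\<parallel> \<parallel>G\<parallel> + O((1 + \<epsilon>)\<^sup>2)\<close>, whose last term is divided by
  \<open>\<parallel>G\<parallel> > \<epsilon> \<kappa>\<close>.\<close>

lemma newton_step_gradient_bound:
  fixes Z Zh :: "real^'f^'n" and \<phi> :: "'n \<Rightarrow> real \<Rightarrow> real" and d :: "'n \<Rightarrow> real" and T :: "'n set"
    and b k \<epsilon> \<gamma> \<mu> :: real
  defines "v \<equiv> \<lambda>M x. supported T (\<lambda>i. \<phi> i ((M *v x) $ i))"
  defines "\<kappa> \<equiv> b * (k * sqrt (real (card T)))"
  assumes Z: "\<And>x. norm (Z *v x) \<le> b * norm x"
    and Zh: "\<And>x. norm (Zh *v x) \<le> b * (1 + \<epsilon>) * norm x"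
    and close: "\<And>x. norm ((Z - Zh) *v x) \<le> b * \<epsilon> * norm x"
    and b: "b \<ge> 0" and eps: "\<epsilon> \<ge> 0" and mu: "\<mu> > 0" and k: "k \<ge> 0" and gam: "\<gamma> \<ge> 0"
    and bounded: "\<And>i x. i \<in> T \<Longrightarrow> \<bar>\<phi> i x\<bar> \<le> k"
    and lip: "\<And>i x y. i \<in> T \<Longrightarrow> \<bar>\<phi> i x - \<phi> i y\<bar> \<le> \<gamma> * \<bar>x - y\<bar>"
    and d: "\<And>i. i \<in> T \<Longrightarrow> 0 \<le> d i \<and> d i \<le> \<gamma>"
    and w: "\<mu> * norm w \<le> \<kappa>"
    and step: "\<mu> *\<^sub>R s + transpose Zh *v supported T (\<lambda>i. d i * (Zh *v s) $ i)
      = - (transpose Zh *v v Zh w + \<mu> *\<^sub>R w)"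
  shows "norm (transpose Z *v v Z (w + s) + \<mu> *\<^sub>R (w + s))
    \<le> \<kappa> * (\<epsilon> + \<gamma> * b\<^sup>2 / \<mu> * (4 * \<epsilon> + 16))"
proof -
  define N where "N = (\<lambda>x. transpose Zh *v supported T (\<lambda>i. d i * (Zh *v x) $ i))"
  define g where "g = \<gamma> * b\<^sup>2 / \<mu>"
  \<comment> \<open>This is \<gamma> times the square of \<open>b * (1 + \<epsilon>)\<close>, a
    bound for the operator norm of \<open>N\<close>.\<close>
  define \<nu> where "\<nu> = g * (1 + \<epsilon>)\<^sup>2 * \<mu>"
  define G where "G = transpose Z *v v Z (w + s) + \<mu> *\<^sub>R (w + s)"
  define p where "p = (transpose Z - transpose Zh) *v v Zh w"
  define e where "e = transpose Z *v (v Z (w + s) - v Zh w)"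
  define q where "q = \<mu> *\<^sub>R w + transpose Z *v v Z (w + s)"
  have g: "g \<ge> 0" and gmu: "g * \<mu> = \<gamma> * b\<^sup>2" using gam mu by (auto simp: g_def)
  have kap: "\<kappa> \<ge> 0" using b k by (simp add: \<kappa>_def)
  have step': "\<mu> *\<^sub>R s + N s = - (transpose Zh *v v Zh w + \<mu> *\<^sub>R w)"
    unfolding N_def by (rule step)
  have lin_supp: "linear (\<lambda>x. supported T (\<lambda>i. d i * (Zh *v x) $ i))"
    by (rule linearI) (auto simp: supported_def vec_eq_iff matrix_vector_right_distrib
        matrix_vector_mult_scaleR algebra_simps)
  have lin: "linear N"
    unfolding N_def using linear_compose[OF lin_supp matrix_vector_mul_linear[of "transpose Zh"]]
    by (simp add: o_def)
  have innerN: "inner x (N y) = (\<Sum>i\<in>T. d i * ((Zh *v x) $ i * (Zh *v y) $ i))" for x y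
    unfolding N_def inner_transpose_mult
    by (simp add: inner_vec_def supported_def if_distrib[of "\<lambda>z. _ * z"] sum.If_cases
        mult.left_commute cong: if_cong)
  have sym: "inner x (N y) = inner y (N x)" for x y
    unfolding innerN by (simp add: mult.commute)
  have psd: "inner x (N x) \<ge> 0" for x
    unfolding innerN using d by (auto intro!: sum_nonneg mult_nonneg_nonneg simp flip: power2_eq_square)
  have Zt: "norm (transpose Z *v y) \<le> b * norm y" for y
    by (rule norm_transpose_mult_le[OF Z])
  have Zht: "norm (transpose Zh *v y) \<le> b * (1 + \<epsilon>) * norm y" for y
    by (rule norm_transpose_mult_le[OF Zh])
  have b1: "b * (1 + \<epsilon>) \<ge> 0" using b eps by simp
  have Nbound: "norm (N x) \<le> \<nu> * norm x" for x
  proof -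
    have "norm (N x) \<le> b * (1 + \<epsilon>) * norm (supported T (\<lambda>i. d i * (Zh *v x) $ i))"
      unfolding N_def by (rule Zht)
    also have "\<dots> \<le> b * (1 + \<epsilon>) * (\<gamma> * norm (Zh *v x))"
      using d gam by (intro mult_left_mono norm_supported_le b1) (auto simp: abs_mult mult_right_mono)
    also have "\<dots> \<le> b * (1 + \<epsilon>) * (\<gamma> * (b * (1 + \<epsilon>) * norm x))"
      using gam by (intro mult_left_mono Zh b1)
    also have "\<dots> = \<nu> * norm x"
      using gmu by (simp add: \<nu>_def power2_eq_square mult_ac)
    finally show ?thesis .
  qed
  have vnorm: "norm (v M x) \<le> k * sqrt (real (card T))" for M x
    unfolding v_def using bounded k by (rule norm_supported_le_card)
  have Zv: "norm (transpose Z *v v M x) \<le> \<kappa>" for M x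
    unfolding \<kappa>_def using Zt[of "v M x"] mult_left_mono[OF vnorm b] by (rule order_trans)
  have Zhv: "norm (transpose Zh *v v M x) \<le> (1 + \<epsilon>) * \<kappa>" for M x
    unfolding \<kappa>_def using order_trans[OF Zht[of "v M x"] mult_left_mono[OF vnorm b1]]
    by (simp add: mult_ac)
  have pnorm: "norm p \<le> \<epsilon> * \<kappa>"
  proof -
    have "p = transpose (Z - Zh) *v v Zh w"
      by (simp add: p_def transpose_def vec_eq_iff matrix_vector_mult_def)
    also have "norm \<dots> \<le> b * \<epsilon> * norm (v Zh w)"
      by (rule norm_transpose_mult_le[OF close])
    also have "\<dots> \<le> b * \<epsilon> * (k * sqrt (real (card T)))"
      using b eps by (intro mult_left_mono vnorm) simp
    finally show ?thesis by (simp add: \<kappa>_def mult_ac)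
  qed
  have qnorm: "norm q \<le> 2 * \<kappa>"
    unfolding q_def using norm_triangle_ineq[of "\<mu> *\<^sub>R w" "transpose Z *v v Z (w + s)"] w
      Zv[of Z "w + s"] mu by simp
  have snorm: "\<mu> * norm s \<le> (2 + \<epsilon>) * \<kappa>"
  proof -
    have "\<mu> * norm s \<le> norm (transpose Zh *v v Zh w + \<mu> *\<^sub>R w)"
      using norm_le_of_regularized_eq[where N = N, OF psd step'] by (simp only: norm_minus_cancel)
    also have "\<dots> \<le> (1 + \<epsilon>) * \<kappa> + \<kappa>"
      using norm_triangle_ineq[of "transpose Zh *v v Zh w" "\<mu> *\<^sub>R w"] w Zhv[of Zh w] mu by simp
    finally show ?thesis by (simp add: algebra_simps)
  qed
  have enorm: "norm e \<le> g * (2 * \<epsilon> + 2) * \<kappa>"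
  proof -
    \<comment> \<open>Only \<open>Z\<close>, not \<open>Zh\<close>, is applied to \<open>s\<close>
      here, which keeps the bound for \<open>e\<close> linear in \<epsilon>.\<close>
    have split: "Z *v (w + s) - Zh *v w = (Z - Zh) *v w + Z *v s"
      by (simp add: matrix_vector_right_distrib matrix_vector_mult_diff_rdistrib)
    have "norm e \<le> b * norm (v Z (w + s) - v Zh w)"
      unfolding e_def by (rule Zt)
    also have "\<dots> \<le> b * (\<gamma> * norm (Z *v (w + s) - Zh *v w))"
      unfolding v_def supported_diff
      by (intro mult_left_mono norm_supported_le b) (use lip gam in auto)
    also have "\<dots> \<le> b * (\<gamma> * (b * \<epsilon> * norm w + b * norm s))"
      unfolding split using gam close[of w] Z[of s]
        norm_triangle_ineq[of "(Z - Zh) *v w" "Z *v s"]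
      by (intro mult_left_mono b) auto
    also have "\<dots> = \<gamma> * b\<^sup>2 * (\<epsilon> * norm w + norm s)"
      by (simp add: power2_eq_square algebra_simps)
    also have "\<dots> = g * (\<epsilon> * (\<mu> * norm w) + \<mu> * norm s)"
      unfolding gmu[symmetric] by (simp add: algebra_simps)
    also have "\<dots> \<le> g * (\<epsilon> * \<kappa> + (2 + \<epsilon>) * \<kappa>)"
      using w snorm eps by (intro mult_left_mono g add_mono) auto
    finally show ?thesis by (simp add: algebra_simps)
  qed
  have NG: "N G = N (transpose Z *v v Z (w + s)) + \<mu> *\<^sub>R N (w + s)"
    by (simp add: G_def linear_add[OF lin] linear_scale[OF lin])
  have Ns: "N s = - (transpose Zh *v v Zh w + \<mu> *\<^sub>R w) - \<mu> *\<^sub>R s"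
    using step' by (simp add: algebra_simps)
  \<comment> \<open>Replacing \<open>N s\<close> by the Newton equation cancels the regularization
    terms of \<open>G\<close>; the difference of the data terms of the two gradients,
    \<open>p + e\<close>, remains.\<close>
  have key: "\<mu> *\<^sub>R G + N G = \<mu> *\<^sub>R (p + e) + N q"
    unfolding NG linear_add[OF lin] Ns unfolding G_def p_def e_def q_def
    by (simp add: linear_add[OF lin] linear_scale[OF lin] matrix_vector_mult_diff_distrib
        matrix_vector_mult_diff_rdistrib algebra_simps)
  have "norm G \<le> \<kappa> * (\<epsilon> + g * (4 * \<epsilon> + 16))"
  proof (cases "\<epsilon> \<ge> 1")
    case False
    \<comment> \<open>Both terms on the right carry a factor \<open>g\<close>; the error
      \<open>p\<close>, of size at most \<open>\<epsilon> * \<kappa>\<close>, is added back at the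
      end.\<close>
    have "\<mu> *\<^sub>R (G - p) + N (G - p) = \<mu> *\<^sub>R e + N (q - p)"
      using key by (simp add: linear_diff[OF lin] algebra_simps)
    from norm_le_of_regularized_eq[where N = N, OF psd this]
    have "\<mu> * norm (G - p) \<le> \<mu> * norm e + \<nu> * norm (q - p)"
      using norm_triangle_ineq[of "\<mu> *\<^sub>R e" "N (q - p)"] Nbound[of "q - p"] mu by simp
    also have "\<dots> \<le> \<mu> * (g * (2 * \<epsilon> + 2) * \<kappa>) + \<nu> * ((2 + \<epsilon>) * \<kappa>)"
    proof (intro add_mono mult_left_mono)
      show "norm (q - p) \<le> (2 + \<epsilon>) * \<kappa>"
        using norm_triangle_ineq4[of q p] qnorm pnorm by (simp add: algebra_simps)
    qed (use enorm mu g in \<open>auto simp: \<nu>_def\<close>)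
    also have "\<dots> = \<mu> * (\<kappa> * (g * (2 * \<epsilon> + 2 + (1 + \<epsilon>)\<^sup>2 * (2 + \<epsilon>))))"
      by (simp add: \<nu>_def algebra_simps)
    finally have "norm (G - p) \<le> \<kappa> * (g * (2 * \<epsilon> + 2 + (1 + \<epsilon>)\<^sup>2 * (2 + \<epsilon>)))"
      using mu by simp
    also have "\<dots> \<le> \<kappa> * (g * (4 * \<epsilon> + 16))"
    proof (intro mult_left_mono kap g)
      \<comment> \<open>For \<epsilon> below 1 the cubic is at most 12, and 2 + 12 fits into
        16.\<close>
      have "(1 + \<epsilon>)\<^sup>2 * (2 + \<epsilon>) \<le> 2\<^sup>2 * 3"
        using False eps by (intro mult_mono power_mono) auto
      then show "2 * \<epsilon> + 2 + (1 + \<epsilon>)\<^sup>2 * (2 + \<epsilon>) \<le> 4 * \<epsilon> + 16" using eps by simp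
    qed
    finally show ?thesis
      using norm_triangle_sub[of G p] pnorm by (simp add: algebra_simps)
  next
    case True
    show ?thesis
    proof (cases "norm G \<le> \<epsilon> * \<kappa>")
      case True
      have "0 \<le> \<kappa> * (g * (4 * \<epsilon> + 16))" using kap g eps by simp
      then show ?thesis using True by (simp add: algebra_simps)
    next
      case False
      then have G: "norm G > 0" using kap eps by (smt (verit) mult_nonneg_nonneg)
      have "\<mu> * (norm G)\<^sup>2 \<le> \<mu> * (norm (p + e) * norm G) + \<nu> * (norm q)\<^sup>2 / 4"
        by (rule norm_square_le_of_regularized_eq[OF lin sym psd Nbound mu key])
      also have "\<dots> \<le> \<mu> * (norm (p + e) * norm G) + \<nu> * (2 * \<kappa>)\<^sup>2 / 4"
        using g mu qnorm by (intro add_left_mono divide_right_mono mult_left_mono power_mono)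
          (auto simp: \<nu>_def)
      also have "\<dots> = \<mu> * (norm (p + e) * norm G + g * (1 + \<epsilon>)\<^sup>2 * \<kappa>\<^sup>2)"
        by (simp add: \<nu>_def algebra_simps power2_eq_square)
      finally have "norm G * norm G \<le> norm (p + e) * norm G + g * (1 + \<epsilon>)\<^sup>2 * \<kappa>\<^sup>2"
        using mu by (simp add: power2_eq_square)
      also have "g * (1 + \<epsilon>)\<^sup>2 * \<kappa>\<^sup>2 \<le> (g * (\<epsilon> + 3) * \<kappa>) * (\<epsilon> * \<kappa>)"
      proof -
        \<comment> \<open>This inequality is equivalent to \<epsilon> being at least 1. The
          split-off factor \<open>\<epsilon> * \<kappa>\<close> is then replaced by the larger
          \<open>norm G\<close>.\<close>
        have "(1 + \<epsilon>)\<^sup>2 \<le> (\<epsilon> + 3) * \<epsilon>" using \<open>\<epsilon> \<ge> 1\<close> by (simp add: power2_eq_square algebra_simps)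
        then have "g * \<kappa>\<^sup>2 * (1 + \<epsilon>)\<^sup>2 \<le> g * \<kappa>\<^sup>2 * ((\<epsilon> + 3) * \<epsilon>)"
          using g by (intro mult_left_mono) auto
        then show ?thesis by (simp add: power2_eq_square mult_ac)
      qed
      also have "\<dots> \<le> (g * (\<epsilon> + 3) * \<kappa>) * norm G"
        using False g eps kap by (intro mult_left_mono) auto
      finally have "norm G * norm G \<le> (norm (p + e) + g * (\<epsilon> + 3) * \<kappa>) * norm G"
        by (simp add: algebra_simps)
      then have "norm G \<le> norm (p + e) + g * (\<epsilon> + 3) * \<kappa>" using G by simp
      also have "\<dots> \<le> \<epsilon> * \<kappa> + g * (2 * \<epsilon> + 2) * \<kappa> + g * (\<epsilon> + 3) * \<kappa>"
        using norm_triangle_ineq[of p e] pnorm enorm by simp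
      also have "\<dots> = \<kappa> * (\<epsilon> + g * (3 * \<epsilon> + 5))" by (simp add: algebra_simps)
      also have "\<dots> \<le> \<kappa> * (\<epsilon> + g * (4 * \<epsilon> + 16))"
        using eps by (intro mult_left_mono add_left_mono kap g) auto
      finally show ?thesis .
    qed
  qed
  then show ?thesis by (simp add: G_def g_def)
qed

subsection \<open>Local push\<close>

text \<open>The removed node loses its self-loop, so only symmetry and 0/1 entries hold for both
  graphs.\<close>

definition undirected :: "real^'n^'n \<Rightarrow> bool" where
  "undirected A \<longleftrightarrow> (\<forall>i j. A $ i $ j \<in> {0, 1}) \<and> (\<forall>i j. A $ i $ j = A $ j $ i)"

lemma undirected_nonneg: "undirected A \<Longrightarrow> A $ i $ j \<ge> 0"
  unfolding undirected_def by (metis insert_iff order_refl singletonD zero_le_one)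

lemma undirected_sym: "undirected A \<Longrightarrow> A $ i $ j = A $ j $ i"
  unfolding undirected_def by blast

lemma deg_eq_card_nbrs:
  assumes "undirected A"
  shows "deg A u = real (card (nbrs A u))"
proof -
  have "deg A u = (\<Sum>t\<in>UNIV. if t \<in> nbrs A u then 1 else 0)"
    unfolding deg_def nbrs_def using assms by (intro sum.cong) (auto simp: undirected_def)
  then show ?thesis by (simp add: sum.If_cases)
qed

lemma deg_nonneg: "undirected A \<Longrightarrow> deg A u \<ge> 0"
  by (simp add: deg_eq_card_nbrs)

lemma deg_zero_or_ge_one:
  assumes "undirected A"
  shows "deg A u = 0 \<or> deg A u \<ge> 1"
  unfolding deg_eq_card_nbrs[OF assms] by (cases "card (nbrs A u)") auto

text \<open>Degrees are cardinalities: an isolated node gives 0 by \<open>0 powr p = 0\<close>, and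
  every other degree is at least one.\<close>

lemma deg_powr_le_one:
  assumes "undirected A" "p \<le> 0"
  shows "deg A u powr p \<le> 1"
proof -
  consider "deg A u = 0" | "deg A u \<ge> 1" using deg_zero_or_ge_one[OF assms(1)] by blast
  then show ?thesis
  proof cases
    case 2
    then have "deg A u powr p \<le> deg A u powr 0" using assms(2) by (intro powr_mono)
    then show ?thesis using 2 by simp
  qed simp
qed

lemma deg_pow_mult_nth: "(deg_pow A p *v x) $ i = deg A i powr p * x $ i"
  by (simp add: deg_pow_def matrix_vector_mult_def if_distrib[of "\<lambda>z. z * _"] cong: if_cong)

lemma norm_deg_pow_mult_le:
  assumes "undirected A" "p \<le> 0"
  shows "norm (deg_pow A p *v x) \<le> norm x"
  by (rule norm_le_componentwise_cart)
    (use deg_powr_le_one[OF assms] in \<open>auto simp: deg_pow_mult_nth abs_mult mult_left_le_one_le\<close>)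

text \<open>Identifies the residue update of a push with a linear map applied to the pushed entry.
  At degree zero both sides vanish, since division by zero gives zero.\<close>

lemma adjacency_inverse_degree_axis:
  assumes "undirected A"
  shows "A *v (deg_pow A (-1) *v axis v \<rho>) = (\<chi> t. if t \<in> nbrs A v then \<rho> / deg A v else 0)"
proof -
  have "(A *v (deg_pow A (-1) *v axis v \<rho>)) $ t = (if t \<in> nbrs A v then \<rho> / deg A v else 0)" for t
  proof -
    have "(A *v (deg_pow A (-1) *v axis v \<rho>)) $ t = A $ t $ v * (deg A v powr (-1) * \<rho>)"
      unfolding matrix_vector_mult_def[of A]
      by (simp add: deg_pow_mult_nth axis_def if_distrib[of "\<lambda>z. _ * z"] cong: if_cong)
    also have "A $ t $ v = (if t \<in> nbrs A v then 1 else 0)"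
      using assms undirected_sym[OF assms, of t v] by (auto simp: undirected_def nbrs_def)
    also have "deg A v powr (-1) = 1 / deg A v"
      using deg_nonneg[OF assms, of v] by (simp add: powr_minus_divide)
    finally show ?thesis by simp
  qed
  then show ?thesis by (simp add: vec_eq_iff)
qed

section \<open>Contractivity of the normalized adjacency matrix\<close>

lemma prop_matrix_mult:
  "prop_matrix A *v x = deg_pow A (-1/2) *v (A *v (deg_pow A (-1/2) *v x))"
  by (simp add: prop_matrix_def matrix_vector_mul_assoc matrix_mul_assoc)

text \<open>The row sum is one, except at an isolated node, where it is zero.\<close>

lemma sum_inverse_degree_le:
  assumes "undirected A"
  shows "(\<Sum>j\<in>UNIV. A $ i $ j * (deg A i powr (-1/2))\<^sup>2) \<le> 1"
proof -
  have "(deg A i powr (-1/2))\<^sup>2 = 1 / deg A i"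
    using deg_nonneg[OF assms, of i]
    by (simp add: power2_eq_square powr_add[symmetric] powr_minus_divide)
  then show ?thesis
    by (simp add: sum_divide_distrib[symmetric] deg_def[symmetric])
qed

text \<open>The Schur test: \<open>A\<^sub>i\<^sub>j\<close> is split as \<open>A\<^sub>i\<^sub>j\<^bsup>1/2\<^esup> A\<^sub>i\<^sub>j\<^bsup>1/2\<^esup>\<close> before applying Cauchy-Schwarz.\<close>

lemma norm_prop_matrix_mult_le:
  fixes A :: "real^'n^'n"
  assumes A: "undirected A"
  shows "norm (prop_matrix A *v x) \<le> norm x"
proof -
  define s where "s i = deg A i powr (-1/2)" for i
  \<comment> \<open>Entries in {0, 1} are their own square roots, which gives the splitting for the
    Schur test.\<close>
  have AA: "A $ i $ j * A $ i $ j = A $ i $ j" for i j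
    using A by (auto simp: undirected_def)
  have nth: "(prop_matrix A *v x) $ i = (\<Sum>j\<in>UNIV. (A $ i $ j * s i) * (A $ i $ j * (s j * x $ j)))" for i
  proof -
    have "(prop_matrix A *v x) $ i = s i * (\<Sum>j\<in>UNIV. A $ i $ j * (s j * x $ j))"
      by (simp add: prop_matrix_mult deg_pow_mult_nth s_def matrix_vector_mult_def[of A])
    also have "\<dots> = (\<Sum>j\<in>UNIV. (A $ i $ j * A $ i $ j) * (s i * (s j * x $ j)))"
      by (simp add: AA sum_distrib_left mult_ac)
    finally show ?thesis by (simp add: mult_ac)
  qed
  have row: "((prop_matrix A *v x) $ i)\<^sup>2 \<le> (\<Sum>j\<in>UNIV. A $ i $ j * (s j * x $ j)\<^sup>2)" for i
  proof -
    have "((prop_matrix A *v x) $ i)\<^sup>2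
      \<le> (\<Sum>j\<in>UNIV. (A $ i $ j * s i)\<^sup>2) * (\<Sum>j\<in>UNIV. (A $ i $ j * (s j * x $ j))\<^sup>2)"
      unfolding nth by (rule Cauchy_Schwarz_ineq_sum)
    also have "(\<Sum>j\<in>UNIV. (A $ i $ j * s i)\<^sup>2) = (\<Sum>j\<in>UNIV. A $ i $ j * (s i)\<^sup>2)"
      by (simp add: power_mult_distrib power2_eq_square[of "A $ _ $ _"] AA)
    also have "(\<Sum>j\<in>UNIV. (A $ i $ j * (s j * x $ j))\<^sup>2) = (\<Sum>j\<in>UNIV. A $ i $ j * (s j * x $ j)\<^sup>2)"
      by (simp add: power_mult_distrib power2_eq_square[of "A $ _ $ _"] AA)
    also have "(\<Sum>j\<in>UNIV. A $ i $ j * (s i)\<^sup>2) * (\<Sum>j\<in>UNIV. A $ i $ j * (s j * x $ j)\<^sup>2)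
      \<le> 1 * (\<Sum>j\<in>UNIV. A $ i $ j * (s j * x $ j)\<^sup>2)"
      using sum_inverse_degree_le[OF A, of i] undirected_nonneg[OF A]
      by (intro mult_right_mono sum_nonneg) (auto simp: s_def)
    finally show ?thesis by simp
  qed
  have "(\<Sum>i\<in>UNIV. ((prop_matrix A *v x) $ i)\<^sup>2) \<le> (\<Sum>i\<in>UNIV. \<Sum>j\<in>UNIV. A $ i $ j * (s j * x $ j)\<^sup>2)"
    by (intro sum_mono row)
  \<comment> \<open>Symmetry turns column sums into row sums, so the row bound applies a second
    time.\<close>
  also have "\<dots> = (\<Sum>j\<in>UNIV. \<Sum>i\<in>UNIV. A $ j $ i * (s j * x $ j)\<^sup>2)"
    using undirected_sym[OF A] by (subst sum.swap) simp
  also have "\<dots> = (\<Sum>j\<in>UNIV. (\<Sum>i\<in>UNIV. A $ j $ i * (s j)\<^sup>2) * (x $ j)\<^sup>2)"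
    by (simp add: sum_distrib_right power_mult_distrib mult.assoc)
  also have "\<dots> \<le> (\<Sum>j\<in>UNIV. 1 * (x $ j)\<^sup>2)"
    using sum_inverse_degree_le[OF A] by (intro sum_mono mult_right_mono) (auto simp: s_def)
  finally show ?thesis
    by (simp add: norm_vec_def L2_set_def)
qed

lemma norm_prop_matrix_pow_le:
  assumes "undirected A"
  shows "norm (((*v) (prop_matrix A) ^^ l) x) \<le> norm x"
  by (induction l) (auto intro: order_trans[OF norm_prop_matrix_mult_le[OF assms]])

section \<open>Columns of the exact embedding\<close>

lemma column_matrix_mult: "column j (A ** B) = A *v column j B"
  by (simp add: column_def matrix_matrix_mult_def matrix_vector_mult_def)

lemma column_funpow_matrix_mult:
  fixes P :: "real^'n^'n" and X :: "real^'f^'n"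
  shows "column j (((**) P ^^ l) X) = ((*v) P ^^ l) (column j X)"
  by (induction l) (auto simp: column_matrix_mult)

lemma column_embedding:
  "column j (embedding L wt E)
    = (\<Sum>l\<le>L. wt l *\<^sub>R ((*v) (prop_matrix (adj E)) ^^ l) (column j (feat E)))"
  unfolding embedding_def column_funpow_matrix_mult[symmetric]
  by (simp add: column_def vec_eq_iff)

lemma norm_weighted_sum_le:
  fixes f :: "nat \<Rightarrow> 'a::real_normed_vector"
  assumes w: "(\<Sum>l\<le>L. \<bar>wt l\<bar>) \<le> 1" and f: "\<And>l. l \<le> L \<Longrightarrow> norm (f l) \<le> b" and b: "b \<ge> 0"
  shows "norm (\<Sum>l\<le>L. wt l *\<^sub>R f l) \<le> b"
proof -
  have "norm (\<Sum>l\<le>L. wt l *\<^sub>R f l) \<le> (\<Sum>l\<le>L. \<bar>wt l\<bar> * b)"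
    by (rule order_trans[OF norm_sum]) (auto intro!: sum_mono mult_left_mono f)
  also have "\<dots> = (\<Sum>l\<le>L. \<bar>wt l\<bar>) * b" by (simp add: sum_distrib_right)
  also have "\<dots> \<le> 1 * b" using w b by (rule mult_right_mono)
  finally show ?thesis by simp
qed

lemma norm_column_embedding_le:
  assumes "undirected (adj E)" "(\<Sum>l\<le>L. \<bar>wt l\<bar>) \<le> 1" "norm (column j (feat E)) \<le> 1"
  shows "norm (column j (embedding L wt E)) \<le> 1"
  unfolding column_embedding using assms
  by (intro norm_weighted_sum_le order_trans[OF norm_prop_matrix_pow_le]) auto

text \<open>If all residues vanished, these equations would make \<open>q l\<close>, scaled by
  \<open>deg_pow A (-1/2)\<close>, the exact l-th propagation of a signal that is zero at isolated
  nodes. Residues measure the defect.\<close>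

definition push_invariant :: "real^'n^'n \<Rightarrow> nat \<Rightarrow> real^'n \<Rightarrow> 'n push_state \<Rightarrow> bool" where
  "push_invariant A L x s \<longleftrightarrow>
     fst s 0 + snd s 0 = deg_pow A (1/2) *v x \<and>
     (\<forall>l<L. fst s (Suc l) + snd s (Suc l) = A *v (deg_pow A (-1) *v fst s l))"

lemma push_invariant_adjust: "push_invariant A L x (adjust_state A x s)"
  by (simp add: push_invariant_def adjust_state_def)

text \<open>At the pushed level reserve and residue change by opposite amounts; at the next level
  both sides of the equation gain the same spread vector.\<close>

lemma push_invariant_step:
  assumes A: "undirected A" and "push_step A L rmax s s'" and inv: "push_invariant A L x s"
  shows "push_invariant A L x s'"
  using assms(2)
proof cases
  case (1 l r v q)
  show ?thesis
    using inv unfolding push_invariant_def 1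
    by (auto simp: adjacency_inverse_degree_axis[OF A, symmetric] matrix_vector_right_distrib
        algebra_simps)
qed

lemma push_invariant_steps:
  assumes A: "undirected A" and "(push_step A L rmax)\<^sup>*\<^sup>* s s'" and "push_invariant A L x s"
  shows "push_invariant A L x s'"
  using assms(2,3) by (induction rule: rtranclp_induct) (auto intro: push_invariant_step[OF A])

text \<open>After scaling, the error at each level is the propagated previous error minus the scaled
  residue. Propagation is contractive, so each of the levels below \<open>L\<close> adds at most
  \<open>sqrt n * rmax\<close>. Any start satisfying the invariant is allowed, hence also an
  adjusted one.\<close>

lemma norm_push_output_error_le:
  fixes A :: "real^'n^'n"
  assumes A: "undirected A" and x: "\<And>i. deg A i = 0 \<Longrightarrow> x $ i = 0"
    and w: "(\<Sum>l\<le>L. \<bar>wt l\<bar>) \<le> 1"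
    and run: "push_run A L rmax s s'" and inv: "push_invariant A L x s"
  shows "norm (push_output A L wt s' - (\<Sum>l\<le>L. wt l *\<^sub>R ((*v) (prop_matrix A) ^^ l) x))
    \<le> sqrt (real CARD('n)) * real L * rmax"
proof -
  obtain q r where steps: "(push_step A L rmax)\<^sup>*\<^sup>* s (q, r)"
    and small: "\<And>l v. l < L \<Longrightarrow> \<bar>r l $ v\<bar> \<le> rmax" and s': "s' = (q(L := q L + r L), r(L := 0))"
    using run unfolding push_run_def by blast
  have inv': "push_invariant A L x (q, r)"
    by (rule push_invariant_steps[OF A steps inv])
  let ?D = "\<lambda>y. deg_pow A (-(1/2)) *v y"
  let ?P = "\<lambda>l. ((*v) (prop_matrix A) ^^ l) x"
  define t where "t = sqrt (real CARD('n)) * rmax"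
  have q0: "q 0 = deg_pow A (1/2) *v x - r 0"
    using inv' by (simp add: push_invariant_def algebra_simps)
  have qS: "q (Suc l) = A *v (deg_pow A (-1) *v q l) - r (Suc l)" if "l < L" for l
    using inv' that by (simp add: push_invariant_def algebra_simps)
  \<comment> \<open>The two powers cancel except at isolated nodes, where \<open>x\<close> is zero
    by assumption.\<close>
  have Dx: "?D (deg_pow A (1/2) *v x) = x"
  proof -
    have "deg A i powr (- (1/2)) * (deg A i powr (1/2) * x $ i) = x $ i" for i
      using x[of i] by (cases "deg A i = 0") (auto simp: mult.assoc[symmetric] powr_add[symmetric])
    then show ?thesis by (simp add: vec_eq_iff deg_pow_mult_nth)
  qed
  have DA: "?D (A *v (deg_pow A (-1) *v y)) = prop_matrix A *v ?D y" for y
  proof -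
    have "deg_pow A (-1) *v y = ?D (?D y)"
      by (simp add: vec_eq_iff deg_pow_mult_nth mult.assoc[symmetric] powr_add[symmetric])
    then show ?thesis by (simp add: prop_matrix_mult)
  qed
  have Dr: "norm (?D (r l)) \<le> t" if "l < L" for l
  proof -
    have "norm (?D (r l)) \<le> norm (r l)"
      by (rule norm_deg_pow_mult_le[OF A]) simp
    also have "\<dots> \<le> norm (rmax *\<^sub>R (1 :: real^'n))"
      by (rule norm_le_componentwise_cart) (use small[OF that] in \<open>auto intro: order_trans[OF _ abs_ge_self]\<close>)
    also have "norm (1 :: real^'n) = sqrt (real CARD('n))"
      by (simp add: norm_vec_def L2_set_def)
    then have "norm (rmax *\<^sub>R (1 :: real^'n)) = t"
      using order_trans[OF abs_ge_zero small[OF that]] by (simp add: t_def)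
    finally show ?thesis .
  qed
  have err: "norm (?D (q l) - ?P l) \<le> real (Suc l) * t" if "l < L" for l
    using that
  proof (induction l)
    case 0
    have "?D (q 0) - ?P 0 = - ?D (r 0)"
      unfolding q0 matrix_vector_mult_diff_distrib Dx by simp
    then show ?case using Dr[of 0] 0 by simp
  next
    case (Suc l)
    have "?D (q (Suc l)) - ?P (Suc l) = prop_matrix A *v (?D (q l) - ?P l) - ?D (r (Suc l))"
      using Suc by (simp add: qS matrix_vector_mult_diff_distrib DA)
    also have "norm \<dots> \<le> norm (?D (q l) - ?P l) + t"
      using norm_triangle_ineq4 norm_prop_matrix_mult_le[OF A] Dr[OF Suc.prems]
      by (meson add_mono order_trans)
    also have "\<dots> \<le> real (Suc l) * t + t" using Suc by simp
    finally show ?case by (simp add: algebra_simps)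
  qed
  \<comment> \<open>Moving the last residue into the reserve removes the defect at level
    \<open>L\<close>; hence the factor \<open>L\<close> and not \<open>L + 1\<close>.\<close>
  have errL: "norm (?D (q L + r L) - ?P L) \<le> real L * t"
  proof (cases L)
    case 0
    then show ?thesis by (simp add: q0 Dx)
  next
    case (Suc l)
    then have "?D (q L + r L) - ?P L = prop_matrix A *v (?D (q l) - ?P l)"
      by (simp add: qS matrix_vector_mult_diff_distrib DA)
    then show ?thesis
      using order_trans[OF norm_prop_matrix_mult_le[OF A] err[of l]] Suc by simp
  qed
  \<comment> \<open>For \<open>L = 0\<close> the threshold may be negative, so the sign is taken
    from the product.\<close>
  have t: "real L * t \<ge> 0" using order_trans[OF norm_ge_zero errL] .
  have lev: "norm (?D (fst s' l) - ?P l) \<le> real L * t" if "l \<le> L" for l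
  proof (cases "l = L")
    case False
    then have "l < L" using that by simp
    then have "t \<ge> 0" using order_trans[OF norm_ge_zero Dr] by blast
    then have "real (Suc l) * t \<le> real L * t" using \<open>l < L\<close> by (intro mult_right_mono) auto
    then show ?thesis using err[OF \<open>l < L\<close>] False by (simp add: s')
  qed (simp add: s' errL)
  have "push_output A L wt s' - (\<Sum>l\<le>L. wt l *\<^sub>R ?P l) = (\<Sum>l\<le>L. wt l *\<^sub>R (?D (fst s' l) - ?P l))"
    by (simp add: push_output_def sum_subtractf scaleR_diff_right)
  also have "norm \<dots> \<le> real L * t"
    by (rule norm_weighted_sum_le[OF w lev t])
  finally show ?thesis by (simp add: t_def mult_ac)
qed

section \<open>Mass bound for runs from the initial state\<close>

definition l1_norm :: "real^'n \<Rightarrow> real" where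
  "l1_norm x = (\<Sum>i\<in>UNIV. \<bar>x $ i\<bar>)"

lemma l1_norm_zero [simp]: "l1_norm 0 = 0"
  by (simp add: l1_norm_def)

lemma l1_norm_nonneg: "l1_norm x \<ge> 0"
  by (simp add: l1_norm_def sum_nonneg)

lemma l1_norm_triangle: "l1_norm (x + y) \<le> l1_norm x + l1_norm y"
  unfolding l1_norm_def sum.distrib[symmetric] by (intro sum_mono) simp

lemma l1_norm_axis: "l1_norm (axis v \<rho>) = \<bar>\<rho>\<bar>"
  by (simp add: l1_norm_def axis_def if_distrib[of abs] cong: if_cong)

lemma l1_norm_clear_entry: "l1_norm (x - axis v (x $ v)) = l1_norm x - \<bar>x $ v\<bar>"
proof -
  have "l1_norm (x - axis v (x $ v)) = (\<Sum>i\<in>UNIV. \<bar>x $ i\<bar> - (if i = v then \<bar>x $ v\<bar> else 0))"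
    unfolding l1_norm_def by (intro sum.cong) (auto simp: axis_def)
  then show ?thesis by (simp add: sum_subtractf l1_norm_def)
qed

text \<open>All neighbors receive equal shares, so no mass is created; at an isolated node it is
  lost.\<close>

lemma l1_norm_spread:
  assumes "undirected A"
  shows "l1_norm (\<chi> t. if t \<in> nbrs A v then \<rho> / deg A v else 0) \<le> \<bar>\<rho>\<bar>"
proof -
  have "l1_norm (\<chi> t. if t \<in> nbrs A v then \<rho> / deg A v else 0) = deg A v * \<bar>\<rho> / deg A v\<bar>"
    by (simp add: l1_norm_def if_distrib[of abs] sum.If_cases deg_eq_card_nbrs[OF assms]
        cong: if_cong)
  also have "\<dots> \<le> \<bar>\<rho>\<bar>" using deg_nonneg[OF assms, of v] by (simp add: abs_divide)
  finally show ?thesis .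
qed

text \<open>A push at level \<open>l\<close> moves mass from the residue at \<open>l\<close> both to the reserve at \<open>l\<close> and to the
  residue at \<open>l + 1\<close>. Counting all residues up to level \<open>k\<close> but only the reserve at \<open>k\<close> makes this
  quantity nonincreasing.\<close>

definition push_mass :: "nat \<Rightarrow> 'n::finite push_state \<Rightarrow> real" where
  "push_mass k s = (\<Sum>l\<le>k. l1_norm (snd s l)) + l1_norm (fst s k)"

text \<open>A push below level \<open>k\<close> shifts mass between counted residues. At level
  \<open>k\<close> it goes to the counted reserve, while residue \<open>k + 1\<close> is not
  counted. Above \<open>k\<close> nothing counted changes.\<close>

lemma push_mass_step:
  assumes A: "undirected A" and "push_step A L rmax s s'"
  shows "push_mass k s' \<le> push_mass k s"
  using assms(2)
proof cases
  case (1 l r v q)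
  define \<rho> where "\<rho> = r l $ v"
  define N where "N = (\<chi> t. if t \<in> nbrs A v then \<rho> / deg A v else 0)"
  define r' where "r' = r(l := r l - axis v \<rho>, Suc l := r (Suc l) + N)"
  have lev: "l1_norm (r' i)
      \<le> l1_norm (r i) + ((if i = Suc l then \<bar>\<rho>\<bar> else 0) - (if i = l then \<bar>\<rho>\<bar> else 0))" for i
    using l1_norm_clear_entry[of "r l" v] l1_norm_spread[OF A, of v \<rho>]
      l1_norm_triangle[of "r (Suc l)" N]
    by (auto simp: r'_def N_def \<rho>_def)
  have "(\<Sum>i\<le>k. l1_norm (r' i)) \<le> (\<Sum>i\<le>k. l1_norm (r i)
      + ((if i = Suc l then \<bar>\<rho>\<bar> else 0) - (if i = l then \<bar>\<rho>\<bar> else 0)))"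
    by (intro sum_mono lev)
  also have "\<dots> = (\<Sum>i\<le>k. l1_norm (r i))
      + ((if Suc l \<le> k then \<bar>\<rho>\<bar> else 0) - (if l \<le> k then \<bar>\<rho>\<bar> else 0))"
    by (simp add: sum.distrib sum_subtractf)
  finally have "(\<Sum>i\<le>k. l1_norm (r' i)) \<le> \<dots>" .
  moreover have "l1_norm ((q(l := q l + axis v \<rho>)) k) \<le> l1_norm (q k) + (if l = k then \<bar>\<rho>\<bar> else 0)"
    using l1_norm_triangle[of "q l" "axis v \<rho>"] by (auto simp: l1_norm_axis)
  ultimately show ?thesis
    unfolding push_mass_def 1 \<rho>_def[symmetric] N_def[symmetric] r'_def[symmetric] snd_conv fst_conv
    by (auto split: if_splits)
qed

lemma push_mass_steps:
  assumes A: "undirected A" and "(push_step A L rmax)\<^sup>*\<^sup>* s s'"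
  shows "push_mass k s' \<le> push_mass k s"
  using assms(2) by (induction rule: rtranclp_induct) (auto intro: order_trans push_mass_step[OF A])

lemma push_mass_init: "push_mass k (init_state A x) = l1_norm (deg_pow A (1/2) *v x)"
proof -
  have "(\<Sum>l\<le>k. l1_norm (((\<lambda>_. 0)(0 := deg_pow A (1/2) *v x)) l))
      = (\<Sum>l\<le>k. if l = 0 then l1_norm (deg_pow A (1/2) *v x) else 0)"
    by (intro sum.cong) auto
  then show ?thesis by (simp add: push_mass_def init_state_def)
qed

text \<open>The mass bounds each reserve in the 1-norm, which dominates the Euclidean norm. It also
  counts the residue at level \<open>k\<close>, so the final move at level \<open>L\<close> is
  covered.\<close>

lemma norm_push_output_init_le:
  assumes A: "undirected A" and w: "(\<Sum>l\<le>L. \<bar>wt l\<bar>) \<le> 1"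
    and x: "l1_norm (deg_pow A (1/2) *v x) \<le> 1"
    and run: "push_run A L rmax (init_state A x) s"
  shows "norm (push_output A L wt s) \<le> 1"
proof -
  obtain q r where steps: "(push_step A L rmax)\<^sup>*\<^sup>* (init_state A x) (q, r)"
    and s: "s = (q(L := q L + r L), r(L := 0))"
    using run unfolding push_run_def by blast
  have mass: "push_mass k (q, r) \<le> 1" for k
    using push_mass_steps[OF A steps, of k] x by (simp add: push_mass_init)
  have "l1_norm (fst s l) \<le> 1" for l
  proof -
    have "l1_norm (r l) \<le> (\<Sum>i\<le>l. l1_norm (r i))"
      by (intro member_le_sum) (auto simp: l1_norm_nonneg)
    then have "l1_norm (q l) + l1_norm (r l) \<le> 1"
      using mass[of l] by (simp add: push_mass_def)
    then show ?thesis
      using l1_norm_triangle[of "q l" "r l"] l1_norm_nonneg[of "r l"] by (auto simp: s)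
  qed
  moreover have "norm y \<le> l1_norm y" for y :: "real^'n"
    unfolding l1_norm_def by (rule norm_le_l1_cart)
  ultimately have "norm (deg_pow A (-1/2) *v fst s l) \<le> 1" for l
    using norm_deg_pow_mult_le[OF A, of "-1/2" "fst s l"] by (smt (verit) divide_nonpos_pos)
  then show ?thesis
    unfolding push_output_def by (intro norm_weighted_sum_le w) auto
qed

subsection \<open>Gradient and Hessian of the loss\<close>

lemma grad_eqI:
  assumes "GDERIV f w :> g"
  shows "grad f w = g"
  unfolding grad_def
proof (rule the_equality[where P = "\<lambda>g. GDERIV f w :> g", OF assms])
  fix g' assume "GDERIV f w :> g'"
  then have "(\<lambda>h. inner h g') = (\<lambda>h. inner h g)"
    using assms unfolding gderiv_def by (rule has_derivative_unique)
  then show "g' = g" by (metis inner_commute vector_eq_rdot)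
qed

lemma inner_supported: "inner y (supported T a) = (\<Sum>i\<in>T. y $ i * a i)"
  by (simp add: inner_vec_def supported_def if_distrib[of "\<lambda>z. _ * z"] sum.If_cases cong: if_cong)

lemma supported_eq_sum_axis: "supported T a = (\<Sum>i\<in>T. a i *\<^sub>R axis i 1)"
  by (simp add: vec_eq_iff supported_def axis_def if_distrib[of "\<lambda>z. _ * z"] cong: if_cong)

lemma has_derivative_matrix_vector_nth:
  fixes Z :: "real^'f^'n"
  shows "((\<lambda>w. (Z *v w) $ i) has_derivative (\<lambda>h. (Z *v h) $ i)) (at w)"
  by (rule bounded_linear_imp_has_derivative)
    (intro bounded_linear_compose[OF bounded_linear_vec_nth matrix_vector_mul_bounded_linear])

lemma has_derivative_compose_matrix_vector_nth:
  fixes Z :: "real^'f^'n"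
  assumes "DERIV f ((Z *v w) $ i) :> D"
  shows "((\<lambda>w. f ((Z *v w) $ i)) has_derivative (\<lambda>h. D * (Z *v h) $ i)) (at w)"
  using has_derivative_compose[OF has_derivative_matrix_vector_nth
      assms[unfolded has_field_derivative_def]] .

text \<open>The regularizer is added once per training node, whence the factor
  \<open>card T\<close>.\<close>

lemma grad_total_loss:
  fixes Z :: "real^'f^'n" and Y :: "real^'n"
  assumes "\<And>i z. i \<in> T \<Longrightarrow> (\<lambda>z. loss z (Y $ i)) differentiable (at z)"
  shows "GDERIV (total_loss loss lam T Z Y) w :>
      transpose Z *v supported T (\<lambda>i. dloss loss (Y $ i) ((Z *v w) $ i)) + (lam * real (card T)) *\<^sub>R w"
    and "grad (total_loss loss lam T Z Y) w =
      transpose Z *v supported T (\<lambda>i. dloss loss (Y $ i) ((Z *v w) $ i)) + (lam * real (card T)) *\<^sub>R w"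
proof -
  let ?g = "transpose Z *v supported T (\<lambda>i. dloss loss (Y $ i) ((Z *v w) $ i)) + (lam * real (card T)) *\<^sub>R w"
  have D: "DERIV (\<lambda>z. loss z (Y $ i)) z :> dloss loss (Y $ i) z" if "i \<in> T" for i z
    using assms[OF that] by (simp add: DERIV_deriv_iff_real_differentiable)
  have sq: "((\<lambda>w. lam / 2 * (norm w)\<^sup>2) has_derivative (\<lambda>h. lam * inner h w)) (at w)"
    unfolding power2_norm_eq_inner
    by (rule derivative_eq_intros refl)+ (auto simp: inner_commute algebra_simps)
  have "(total_loss loss lam T Z Y has_derivative
      (\<lambda>h. \<Sum>i\<in>T. dloss loss (Y $ i) ((Z *v w) $ i) * (Z *v h) $ i + lam * inner h w)) (at w)"
    unfolding total_loss_def[abs_def]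
    by (intro has_derivative_sum has_derivative_add sq has_derivative_compose_matrix_vector_nth D)
  also have "(\<lambda>h. \<Sum>i\<in>T. dloss loss (Y $ i) ((Z *v w) $ i) * (Z *v h) $ i + lam * inner h w)
      = (\<lambda>h. inner h ?g)"
    unfolding inner_add_right inner_transpose_mult inner_supported
    by (simp add: sum.distrib mult.commute mult.left_commute)
  finally show *: "GDERIV (total_loss loss lam T Z Y) w :> ?g"
    by (simp add: gderiv_def)
  show "grad (total_loss loss lam T Z Y) w = ?g"
    by (rule grad_eqI[OF *])
qed

text \<open>Stated through the action on \<open>h\<close>, the form in which the Newton equation is
  used.\<close>

lemma hessian_total_loss:
  fixes Z :: "real^'f^'n" and Y :: "real^'n"
  assumes "\<And>i z. i \<in> T \<Longrightarrow> (\<lambda>z. loss z (Y $ i)) differentiable (at z)"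
    and "\<And>i z. i \<in> T \<Longrightarrow> dloss loss (Y $ i) differentiable (at z)"
  shows "hessian (total_loss loss lam T Z Y) w *v h =
    transpose Z *v supported T (\<lambda>i. deriv (dloss loss (Y $ i)) ((Z *v w) $ i) * (Z *v h) $ i)
      + (lam * real (card T)) *\<^sub>R h"
proof -
  have D: "DERIV (dloss loss (Y $ i)) z :> deriv (dloss loss (Y $ i)) z" if "i \<in> T" for i z
    using assms(2)[OF that] by (simp add: DERIV_deriv_iff_real_differentiable)
  have grad_eq: "grad (total_loss loss lam T Z Y) = (\<lambda>w. transpose Z *v
      supported T (\<lambda>i. dloss loss (Y $ i) ((Z *v w) $ i)) + (lam * real (card T)) *\<^sub>R w)"
    by (intro ext grad_total_loss(2) assms(1))
  have D2: "(grad (total_loss loss lam T Z Y) has_derivative (\<lambda>h. transpose Z *v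
      supported T (\<lambda>i. deriv (dloss loss (Y $ i)) ((Z *v w) $ i) * (Z *v h) $ i)
      + (lam * real (card T)) *\<^sub>R h)) (at w)"
    unfolding grad_eq supported_eq_sum_axis
    by (intro has_derivative_add has_derivative_scaleR_right has_derivative_ident
        bounded_linear.has_derivative[OF matrix_vector_mul_bounded_linear]
        has_derivative_sum has_derivative_scaleR_left has_derivative_compose_matrix_vector_nth D)
  have "(grad (total_loss loss lam T Z Y) has_derivative
      (\<lambda>h. hessian (total_loss loss lam T Z Y) w *v h)) (at w)"
    unfolding hessian_def by (rule jacobian_works[THEN iffD1, OF differentiableI[OF D2]])
  from has_derivative_unique[OF this D2] show ?thesis by (rule fun_cong)
qed

lemma matrix_inv_solve:
  fixes H :: "real^'n^'n"
  assumes "\<And>x. H *v x = 0 \<Longrightarrow> x = 0"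
  shows "H *v (matrix_inv H *v y) = y"
proof -
  have "invertible H"
    unfolding invertible_left_inverse matrix_left_invertible_ker using assms by blast
  then have "H ** matrix_inv H = mat 1"
    unfolding invertible_def matrix_inv_def by (rule someI2_ex) simp
  then show ?thesis by (simp add: matrix_vector_mul_assoc)
qed

text \<open>Adding the tangent inequalities at two points shows that the first derivative is
  monotone.\<close>

lemma deriv_deriv_nonneg_of_convex:
  fixes f :: "real \<Rightarrow> real"
  assumes "convex_on UNIV f" "\<And>z. f differentiable (at z)" "deriv f differentiable (at x)"
  shows "deriv (deriv f) x \<ge> 0"
proof (rule mono_on_imp_deriv_nonneg[of UNIV "deriv f" _ x])
  have D: "DERIV f z :> deriv f z" for z
    using assms(2) by (simp add: DERIV_deriv_iff_real_differentiable)
  have tangent: "f z - f y \<ge> deriv f y * (z - y)" for y z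
    using assms(1) D by (intro convex_on_imp_above_tangent[of UNIV]) auto
  show "mono_on UNIV (deriv f)"
  proof (rule mono_onI)
    fix y z :: real assume "y \<le> z"
    have "(deriv f z - deriv f y) * (z - y) \<ge> 0"
      using tangent[of y z] tangent[of z y] by (simp add: algebra_simps)
    then show "deriv f y \<le> deriv f z"
      using \<open>y \<le> z\<close> by (cases "y = z") (auto simp: zero_le_mult_iff)
  qed
qed (use assms(3) in \<open>auto simp: DERIV_deriv_iff_real_differentiable\<close>)

lemma lipschitz_on_abs_deriv_le:
  fixes f :: "real \<Rightarrow> real"
  assumes "\<gamma>-lipschitz_on UNIV f" "f differentiable (at x)"
  shows "\<bar>deriv f x\<bar> \<le> \<gamma>"
proof -
  have "(\<lambda>h. (f (x + h) - f x) / h) \<midarrow>0\<rightarrow> deriv f x"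
    using assms(2) by (simp add: DERIV_deriv_iff_real_differentiable[symmetric] DERIV_def)
  then have "((\<lambda>h. \<bar>(f (x + h) - f x) / h\<bar>) \<longlongrightarrow> \<bar>deriv f x\<bar>) (at 0)"
    by (rule tendsto_rabs)
  moreover have "\<forall>\<^sub>F h in at 0. \<bar>(f (x + h) - f x) / h\<bar> \<le> \<gamma>"
  proof (rule eventually_at_topological[THEN iffD2], intro exI[of _ UNIV] conjI ballI impI)
    fix h :: real assume "h \<noteq> 0"
    then show "\<bar>(f (x + h) - f x) / h\<bar> \<le> \<gamma>"
      using lipschitz_onD[OF assms(1), of "x + h" x] by (simp add: dist_real_def divide_le_eq)
  qed auto
  ultimately show ?thesis
    by (rule tendsto_upperbound) simp
qed

text \<open>A vanishing gradient expresses the regularization term through the bounded loss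
  derivatives.\<close>

lemma norm_minimizer_le:
  fixes Z :: "real^'f^'n" and Y :: "real^'n"
  assumes diff: "\<And>i z. i \<in> T \<Longrightarrow> (\<lambda>z. loss z (Y $ i)) differentiable (at z)"
    and bounded: "\<And>i z. i \<in> T \<Longrightarrow> \<bar>dloss loss (Y $ i) z\<bar> \<le> k" and k: "k \<ge> 0" and lam: "lam \<ge> 0"
    and Z: "\<And>x. norm (Z *v x) \<le> b * norm x" and b: "b \<ge> 0"
    and min: "\<And>v. total_loss loss lam T Z Y w \<le> total_loss loss lam T Z Y v"
  shows "grad (total_loss loss lam T Z Y) w = 0"
    and "lam * real (card T) * norm w \<le> b * (k * sqrt (real (card T)))"
proof -
  let ?L = "total_loss loss lam T Z Y"
  let ?v = "supported T (\<lambda>i. dloss loss (Y $ i) ((Z *v w) $ i))"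
  have g: "grad ?L w = transpose Z *v ?v + (lam * real (card T)) *\<^sub>R w"
    by (rule grad_total_loss(2)) (rule diff)
  have "GDERIV ?L w :> grad ?L w"
    unfolding g by (rule grad_total_loss(1)) (rule diff)
  then have "(?L has_derivative (\<lambda>h. inner h (grad ?L w))) (at w)"
    unfolding gderiv_def .
  then have "(\<lambda>h. inner h (grad ?L w)) = (\<lambda>_. 0)"
    by (rule differential_zero_maxmin[OF UNIV_I open_UNIV]) (use min in blast)
  from fun_cong[OF this, of "grad ?L w"] show g0: "grad ?L w = 0" by simp
  have "transpose Z *v ?v + (lam * real (card T)) *\<^sub>R w = 0"
    using g g0 by (rule trans[OF sym])
  then have eq: "(lam * real (card T)) *\<^sub>R w = - (transpose Z *v ?v)"
    by (rule minus_unique[symmetric])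
  have "lam * real (card T) * norm w = norm ((lam * real (card T)) *\<^sub>R w)"
    using lam by simp
  also have "\<dots> = norm (transpose Z *v ?v)"
    unfolding eq by (rule norm_minus_cancel)
  also have "\<dots> \<le> b * norm ?v" by (rule norm_transpose_mult_le[OF Z])
  also have "\<dots> \<le> b * (k * sqrt (real (card T)))"
    by (intro mult_left_mono norm_supported_le_card b k bounded)
  finally show "lam * real (card T) * norm w \<le> b * (k * sqrt (real (card T)))" .
qed

subsection \<open>Node removal\<close>

lemma norm_column_le_l1_norm_deg_pow:
  fixes A :: "real^'n^'n"
  assumes "\<And>i. deg A i \<ge> 1"
  shows "norm x \<le> l1_norm (deg_pow A (1/2) *v x)"
proof -
  have "norm x \<le> norm (deg_pow A (1/2) *v x)"
  proof (rule norm_le_componentwise_cart)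
    fix i
    have "1 * \<bar>x $ i\<bar> \<le> deg A i powr (1/2) * \<bar>x $ i\<bar>"
      using assms[of i] by (intro mult_right_mono ge_one_powr_ge_zero) auto
    then show "norm (x $ i) \<le> norm ((deg_pow A (1/2) *v x) $ i)"
      by (simp add: deg_pow_mult_nth abs_mult)
  qed
  also have "\<dots> \<le> l1_norm (deg_pow A (1/2) *v x)"
    unfolding l1_norm_def by (rule norm_le_l1_cart)
  finally show ?thesis .
qed

lemma undirected_self_loops_imp:
  assumes "undirected_self_loops A"
  shows "undirected A" "deg A i \<ge> 1"
proof -
  show A: "undirected A" using assms by (simp add: undirected_self_loops_def undirected_def)
  have "A $ i $ i \<le> deg A i"
    unfolding deg_def using undirected_nonneg[OF A] by (intro member_le_sum) auto
  then show "deg A i \<ge> 1" using assms by (simp add: undirected_self_loops_def)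
qed

lemma remove_node_simps:
  "i \<noteq> u \<Longrightarrow> lab (remove_node u \<D>) $ i = lab \<D> $ i"
  "column j (feat (remove_node u \<D>)) $ i = (if i = u then 0 else column j (feat \<D>) $ i)"
  "adj (remove_node u \<D>) $ i $ k = (if i = u \<or> k = u then 0 else adj \<D> $ i $ k)"
  by (auto simp: remove_node_def column_def)

lemma undirected_remove_node:
  "undirected (adj \<D>) \<Longrightarrow> undirected (adj (remove_node u \<D>))"
  unfolding undirected_def by (auto simp: remove_node_simps)

lemma norm_column_remove_node_le:
  "norm (column j (feat (remove_node u \<D>))) \<le> norm (column j (feat \<D>))"
  by (rule norm_le_componentwise_cart) (simp add: remove_node_simps)

text \<open>Every surviving node keeps its self-loop, so only \<open>u\<close> can be isolated, and
  its features are zero.\<close>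

lemma column_remove_node_eq_zero:
  assumes "undirected_self_loops (adj \<D>)" "deg (adj (remove_node u \<D>)) i = 0"
  shows "column j (feat (remove_node u \<D>)) $ i = 0"
proof (cases "i = u")
  case False
  have "adj (remove_node u \<D>) $ i $ i \<le> deg (adj (remove_node u \<D>)) i"
    unfolding deg_def
    using undirected_nonneg[OF undirected_remove_node[OF undirected_self_loops_imp(1)[OF assms(1)]]]
    by (intro member_le_sum) auto
  then show ?thesis
    using assms False by (simp add: remove_node_simps undirected_self_loops_def)
qed (simp add: remove_node_simps)

text \<open>The constant 8 is the one required by the Newton estimate, as
  \<open>4 * \<epsilon> + 16 = 2 * (2 * \<epsilon> + 8)\<close>.\<close>

lemma degree_terms_ge_8:
  fixes A :: "real^'n^'n"
  assumes "undirected_self_loops A"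
  shows "4 * sqrt (deg A u) + (\<Sum>v\<in>nbrs A u. 4 / sqrt (deg A v)) \<ge> 8"
proof -
  define s where "s = sqrt (deg A u)"
  have s: "s > 0" using undirected_self_loops_imp(2)[OF assms, of u] by (simp add: s_def)
  have "u \<in> nbrs A u" using assms by (simp add: nbrs_def undirected_self_loops_def)
  then have "4 / sqrt (deg A u) \<le> (\<Sum>v\<in>nbrs A u. 4 / sqrt (deg A v))"
    using deg_nonneg[OF undirected_self_loops_imp(1)[OF assms]] by (intro member_le_sum) auto
  moreover have "8 \<le> 4 * s + 4 / s"
  proof -
    have "0 \<le> (s - 1)\<^sup>2" by simp
    then have "8 * s \<le> (4 * s + 4 / s) * s" using s by (simp add: power2_eq_square algebra_simps)
    then show ?thesis using s by simp
  qed
  ultimately show ?thesis by (simp add: s_def)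
qed

theorem theorem4p4:
  fixes \<D> \<D>' :: "('n::finite, 'f::finite) dataset"
    and u :: 'n and T :: "'n set" and n\<^sub>t :: nat
    and L :: nat and wt :: "nat \<Rightarrow> real"
    and rmax \<epsilon>\<^sub>1 :: real
    and S S' :: "'f \<Rightarrow> 'n push_state"
    and Zh Zh' :: "real ^ 'f ^ 'n"
    and labels :: "real set"
    and loss :: "real \<Rightarrow> real \<Rightarrow> real"
    and lam c c\<^sub>1 \<gamma>\<^sub>1 \<gamma>\<^sub>2 :: real
    and wstar \<Delta> wminus :: "real ^ 'f" and H :: "real ^ 'f ^ 'f"
  assumes graph: "undirected_self_loops (adj \<D>)"
    and normalized: "\<And>j. (\<Sum>i\<in>UNIV. \<bar>(deg_pow (adj \<D>) (1/2) *v column j (feat \<D>)) $ i\<bar>) \<le> 1"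
    and binary: "card labels = 2" "\<And>i. lab \<D> $ i \<in> labels"
    and training: "card T = n\<^sub>t" "n\<^sub>t \<ge> 2"
    and removal: "u \<in> T" "\<D>' = remove_node u \<D>"
    and weights: "(\<Sum>l\<le>L. \<bar>wt l\<bar>) \<le> 1"
    and push: "\<And>j. push_run (adj \<D>) L rmax (init_state (adj \<D>) (column j (feat \<D>))) (S j)"
      "\<And>j. column j Zh = push_output (adj \<D>) L wt (S j)"
    and push': "\<And>j. push_run (adj \<D>') L rmax
                        (adjust_state (adj \<D>') (column j (feat \<D>')) (S j)) (S' j)"
      "\<And>j. column j Zh' = push_output (adj \<D>') L wt (S' j)"
    and eps: "\<epsilon>\<^sub>1 = sqrt (real CARD('n)) * real L * rmax"
    and lam: "lam > 0"
    and convex: "\<And>y. y \<in> labels \<Longrightarrow> convex_on UNIV (\<lambda>z. loss z y)"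
    and diff: "\<And>y z. y \<in> labels \<Longrightarrow> (\<lambda>z. loss z y) differentiable (at z)"
    and diff2: "\<And>y z. y \<in> labels \<Longrightarrow> dloss loss y differentiable (at z)"
    and A1: "\<And>E i w. E \<in> {\<D>, \<D>'} \<Longrightarrow>
                norm (grad (\<lambda>v. loss ((embedding L wt E *v v) $ i) (lab E $ i)) w) \<le> c"
    and A2: "\<And>y z. y \<in> labels \<Longrightarrow> \<bar>dloss loss y z\<bar> \<le> c\<^sub>1"
    and A3: "\<And>y. y \<in> labels \<Longrightarrow> \<gamma>\<^sub>1-lipschitz_on UNIV (dloss loss y)"
    and A4: "\<And>y. y \<in> labels \<Longrightarrow> \<gamma>\<^sub>2-lipschitz_on UNIV (deriv (dloss loss y))"
    and A5: "\<And>E i. E \<in> {\<D>, \<D>'} \<Longrightarrow> norm (row i (feat E)) \<le> 1"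
    and approx: "\<And>j. norm (column j Zh - column j (embedding L wt \<D>)) \<le> \<epsilon>\<^sub>1"
    and minimizer: "\<And>w. w \<noteq> wstar \<Longrightarrow>
          total_loss loss lam T Zh (lab \<D>) wstar < total_loss loss lam T Zh (lab \<D>) w"
    and Delta: "\<Delta> = grad (total_loss loss lam T Zh (lab \<D>)) wstar
                   - grad (total_loss loss lam (T - {u}) Zh' (lab \<D>')) wstar"
    and Hess: "H = hessian (total_loss loss lam (T - {u}) Zh' (lab \<D>')) wstar"
    and wminus: "wminus = wstar + matrix_inv H *v \<Delta>"
  shows "norm (grad (total_loss loss lam (T - {u}) (embedding L wt \<D>') (lab \<D>')) wminus)
    \<le> 4 * c * \<gamma>\<^sub>1 * real CARD('f) / (lam * (real n\<^sub>t - 1))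
      + (c * \<gamma>\<^sub>1 / lam * real CARD('f) + c\<^sub>1 * sqrt (real CARD('f) * (real n\<^sub>t - 1)))
        * (\<epsilon>\<^sub>1 + 2 * \<gamma>\<^sub>1 * real CARD('f) / (lam * (real n\<^sub>t - 1))
            * (2 * \<epsilon>\<^sub>1 + 4 * sqrt (deg (adj \<D>) u)
               + (\<Sum>v\<in>nbrs (adj \<D>) u. 4 / sqrt (deg (adj \<D>) v))))"
proof -
  let ?m = "real n\<^sub>t - 1"
  let ?T' = "T - {u}"
  let ?Z' = "embedding L wt \<D>'"
  let ?F = "real CARD('f)"
  define b where "b = sqrt ?F"
  define \<mu> where "\<mu> = lam * ?m"
  have A: "undirected (adj \<D>)" and deg1: "\<And>i. deg (adj \<D>) i \<ge> 1"
    using undirected_self_loops_imp[OF graph] by auto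
  have A': "undirected (adj \<D>')"
    unfolding removal(2) by (rule undirected_remove_node[OF A])
  have m: "real (card ?T') = ?m" "?m \<ge> 1"
    using training removal(1) by (auto simp: card_Diff_singleton of_nat_diff)
  have mu: "\<mu> > 0" using lam m(2) by (simp add: \<mu>_def)
  have b: "b \<ge> 0" and b2: "b\<^sup>2 = ?F" by (auto simp: b_def)
  have lab_T: "lab \<D> $ i \<in> labels" for i by (rule binary(2))
  have lab_T': "lab \<D>' $ i = lab \<D> $ i" if "i \<in> ?T'" for i
    using that by (simp add: removal(2) remove_node_simps)
  have lab': "lab \<D>' $ i \<in> labels" if "i \<in> ?T'" for i
    using lab_T' that binary(2) by simp
  have c1: "c\<^sub>1 \<ge> 0" using order_trans[OF abs_ge_zero A2[OF lab_T]] .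
  have c: "c \<ge> 0" using order_trans[OF norm_ge_zero A1[of \<D>]] by blast
  have g1: "\<gamma>\<^sub>1 \<ge> 0" using lipschitz_on_nonneg[OF A3[OF lab_T]] .
  have e1: "\<epsilon>\<^sub>1 \<ge> 0" using order_trans[OF norm_ge_zero approx] .
  have l1: "l1_norm (deg_pow (adj \<D>) (1/2) *v column j (feat \<D>)) \<le> 1" for j
    unfolding l1_norm_def by (rule normalized)
  have X: "norm (column j (feat \<D>)) \<le> 1" for j
    using norm_column_le_l1_norm_deg_pow[OF deg1] l1 by (rule order_trans)
  have Zh: "norm (column j Zh) \<le> 1" for j
    unfolding push(2) by (rule norm_push_output_init_le[OF A weights l1 push(1)])
  have Z': "norm (column j ?Z') \<le> 1" for j
    using order_trans[OF norm_column_remove_node_le[of j u \<D>] X] A' weights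
    unfolding removal(2)[symmetric] by (intro norm_column_embedding_le)
  \<comment> \<open>The error bound after the removal is derived here: the adjusted residues satisfy
    the invariant by construction.\<close>
  have close: "norm (column j Zh' - column j ?Z') \<le> \<epsilon>\<^sub>1" for j
    unfolding push'(2) column_embedding eps
  proof (rule norm_push_output_error_le[OF A' _ weights push'(1) push_invariant_adjust])
    show "column j (feat \<D>') $ i = 0" if "deg (adj \<D>') i = 0" for i
      using column_remove_node_eq_zero[OF graph] that unfolding removal(2) by blast
  qed
  \<comment> \<open>The mass bound covers runs from \<open>init_state\<close> only, so the adjusted
    run gets its bound from the triangle inequality.\<close>
  have Zh': "norm (column j Zh') \<le> 1 + \<epsilon>\<^sub>1" for j
    using norm_triangle_sub[of "column j Zh'" "column j ?Z'"] close[of j] Z'[of j] by simp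
  have op_Zh: "norm (Zh *v x) \<le> b * norm x" for x
    using norm_matrix_vector_le_columns[OF Zh] by (simp add: b_def)
  have op_Z': "norm (?Z' *v x) \<le> b * norm x" for x
    using norm_matrix_vector_le_columns[OF Z'] by (simp add: b_def)
  have op_Zh': "norm (Zh' *v x) \<le> b * (1 + \<epsilon>\<^sub>1) * norm x" for x
    using norm_matrix_vector_le_columns[OF Zh'] by (simp add: b_def)
  have op_close: "norm ((?Z' - Zh') *v x) \<le> b * \<epsilon>\<^sub>1 * norm x" for x
    unfolding b_def
  proof (rule norm_matrix_vector_le_columns)
    show "norm (column j (?Z' - Zh')) \<le> \<epsilon>\<^sub>1" for j
    proof -
      have "column j (?Z' - Zh') = column j ?Z' - column j Zh'"
        by (simp add: column_def vec_eq_iff)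
      then show ?thesis using close[of j] by (simp only: norm_minus_commute)
    qed
  qed
  let ?Lh = "total_loss loss lam T Zh (lab \<D>)"
  let ?Lh' = "total_loss loss lam ?T' Zh' (lab \<D>')"
  have min: "?Lh wstar \<le> ?Lh v" for v
    using minimizer[of v] by (cases "v = wstar") auto
  have grad0: "grad ?Lh wstar = 0"
    and wn: "lam * real (card T) * norm wstar \<le> b * (c\<^sub>1 * sqrt (real (card T)))"
    using norm_minimizer_le[of T loss "lab \<D>" c\<^sub>1 lam Zh b wstar,
        OF diff[OF lab_T] A2[OF lab_T] c1 less_imp_le[OF lam] op_Zh b min] by blast+
  define \<kappa> where "\<kappa> = b * (c\<^sub>1 * sqrt ?m)"
  \<comment> \<open>The minimizer bound involves all training nodes, but \<open>\<kappa>\<close> and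
    \<open>\<mu>\<close> one fewer. Dividing by the root of \<open>card T\<close> leaves a left-hand
    side increasing in the count, so the smaller count is admissible.\<close>
  have w: "\<mu> * norm wstar \<le> \<kappa>"
  proof -
    have nt: "real (card T) \<ge> ?m" "real (card T) > 0" using training by auto
    have "sqrt (real (card T)) * (lam * sqrt (real (card T)) * norm wstar)
        \<le> sqrt (real (card T)) * (b * c\<^sub>1)"
      using wn nt by (simp add: algebra_simps)
    then have 1: "lam * sqrt (real (card T)) * norm wstar \<le> b * c\<^sub>1"
      using nt by simp
    have "\<mu> * norm wstar = sqrt ?m * (lam * sqrt ?m * norm wstar)"
      using m by (simp add: \<mu>_def algebra_simps)
    also have "\<dots> \<le> sqrt ?m * (lam * sqrt (real (card T)) * norm wstar)"
      using nt m lam by (intro mult_left_mono mult_right_mono) auto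
    also have "\<dots> \<le> sqrt ?m * (b * c\<^sub>1)"
      using 1 m by (intro mult_left_mono) auto
    finally show ?thesis by (simp add: \<kappa>_def mult_ac)
  qed
  define \<phi> where "\<phi> i = dloss loss (lab \<D>' $ i)" for i
  define d where "d i = deriv (\<phi> i) ((Zh' *v wstar) $ i)" for i
  define s where "s = matrix_inv H *v \<Delta>"
  have diff': "(\<lambda>z. loss z (lab \<D>' $ i)) differentiable (at z)" if "i \<in> ?T'" for i z
    using diff lab'[OF that] .
  have diff2': "dloss loss (lab \<D>' $ i) differentiable (at z)" if "i \<in> ?T'" for i z
    using diff2 lab'[OF that] .
  have mu': "lam * real (card ?T') = \<mu>" by (simp only: m \<mu>_def)
  have grad': "grad (total_loss loss lam ?T' M (lab \<D>')) v
      = transpose M *v supported ?T' (\<lambda>i. \<phi> i ((M *v v) $ i)) + \<mu> *\<^sub>R v" for M :: "real^'f^'n" and v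
    using grad_total_loss(2)[of ?T' loss "lab \<D>'" lam M v] diff' unfolding mu' \<phi>_def by blast
  have Hmult: "H *v x = transpose Zh' *v supported ?T' (\<lambda>i. d i * (Zh' *v x) $ i) + \<mu> *\<^sub>R x" for x
    using hessian_total_loss[of ?T' loss "lab \<D>'" lam Zh' wstar x] diff' diff2'
    unfolding Hess mu' \<phi>_def d_def by blast
  have d: "0 \<le> d i \<and> d i \<le> \<gamma>\<^sub>1" if "i \<in> ?T'" for i
    unfolding d_def \<phi>_def
    using deriv_deriv_nonneg_of_convex[OF convex[OF lab'] diff[OF lab'] diff2[OF lab'], OF that that that]
      abs_le_D1[OF lipschitz_on_abs_deriv_le[OF A3[OF lab'] diff2[OF lab'], OF that that]] by blast
  have posdef: "inner x (transpose Zh' *v supported ?T' (\<lambda>i. d i * (Zh' *v x) $ i)) \<ge> 0" for x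
    unfolding inner_transpose_mult inner_supported using d
    by (intro sum_nonneg) (simp add: mult.left_commute[of _ "d _"] flip: power2_eq_square)
  \<comment> \<open>The regularizer forces a trivial kernel, so \<open>matrix_inv H\<close> is a
    genuine inverse.\<close>
  have Hs: "H *v s = \<Delta>"
    unfolding s_def
  proof (rule matrix_inv_solve)
    fix x assume "H *v x = 0"
    then have "\<mu> *\<^sub>R x + transpose Zh' *v supported ?T' (\<lambda>i. d i * (Zh' *v x) $ i) = 0"
      by (simp add: Hmult add.commute)
    from norm_le_of_regularized_eq[where N = "\<lambda>x. transpose Zh' *v supported ?T' (\<lambda>i. d i * (Zh' *v x) $ i)",
        OF posdef this]
    show "x = 0" using mu by (simp add: mult_le_0_iff)
  qed
  \<comment> \<open>As the old gradient vanishes at \<open>wstar\<close>, \<open>\<Delta>\<close> is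
    minus the new approximate gradient: the update is a Newton step.\<close>
  have step: "\<mu> *\<^sub>R s + transpose Zh' *v supported ?T' (\<lambda>i. d i * (Zh' *v s) $ i)
      = - (transpose Zh' *v supported ?T' (\<lambda>i. \<phi> i ((Zh' *v wstar) $ i)) + \<mu> *\<^sub>R wstar)"
    using Hs unfolding Hmult Delta grad0 grad' by (simp only: add.commute diff_0)
  have lip: "\<bar>\<phi> i x - \<phi> i y\<bar> \<le> \<gamma>\<^sub>1 * \<bar>x - y\<bar>" if "i \<in> ?T'" for i x y
    using lipschitz_onD[OF A3[OF lab'[OF that]], of x y] by (simp add: \<phi>_def dist_real_def)
  have bounded: "\<bar>\<phi> i x\<bar> \<le> c\<^sub>1" if "i \<in> ?T'" for i x
    unfolding \<phi>_def by (rule A2[OF lab'[OF that]])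
  have kap: "b * (c\<^sub>1 * sqrt (real (card ?T'))) = \<kappa>" by (simp only: m \<kappa>_def)
  have "norm (grad (total_loss loss lam ?T' ?Z' (lab \<D>')) wminus)
      \<le> \<kappa> * (\<epsilon>\<^sub>1 + \<gamma>\<^sub>1 * b\<^sup>2 / \<mu> * (4 * \<epsilon>\<^sub>1 + 16))"
    unfolding wminus s_def[symmetric] grad' kap[symmetric]
    by (rule newton_step_gradient_bound[OF op_Z' op_Zh' op_close b e1 mu c1 g1 bounded lip d _ step])
      (use w kap in simp_all)
  also have "\<dots> = c\<^sub>1 * sqrt (?F * ?m) * (\<epsilon>\<^sub>1 + 2 * \<gamma>\<^sub>1 * ?F / (lam * ?m) * (2 * \<epsilon>\<^sub>1 + 8))"
  proof -
    have "\<gamma>\<^sub>1 * ?F / \<mu> * (4 * \<epsilon>\<^sub>1 + 16) = 2 * \<gamma>\<^sub>1 * ?F / \<mu> * (2 * \<epsilon>\<^sub>1 + 8)"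
      by (simp add: field_split_simps)
    moreover have "\<kappa> = c\<^sub>1 * sqrt (?F * ?m)"
      unfolding \<kappa>_def b_def real_sqrt_mult by (rule mult.left_commute)
    ultimately show ?thesis by (simp only: b2 \<mu>_def[symmetric])
  qed
  finally have main: "norm (grad (total_loss loss lam ?T' ?Z' (lab \<D>')) wminus)
      \<le> c\<^sub>1 * sqrt (?F * ?m) * (\<epsilon>\<^sub>1 + 2 * \<gamma>\<^sub>1 * ?F / (lam * ?m) * (2 * \<epsilon>\<^sub>1 + 8))" .
  \<comment> \<open>Here \<open>t\<close> and \<open>x\<close> stand for the nonnegative summands
    containing \<open>c\<close>, and the step from \<open>S\<close> to \<open>S'\<close> replaces 8
    by the degree terms.\<close>
  have arith: "a * (e + k * S) \<le> t + (x + a) * (e + k * S')"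
    if "a \<ge> 0" "e \<ge> 0" "k \<ge> 0" "0 \<le> S" "S \<le> S'" "t \<ge> 0" "x \<ge> 0" for a e k S S' t x :: real
  proof -
    have "a * (e + k * S) \<le> (x + a) * (e + k * S')"
      using that by (intro mult_mono add_mono mult_left_mono) auto
    then show ?thesis using that by simp
  qed
  show ?thesis
    by (rule order_trans[OF main arith])
      (use degree_terms_ge_8[OF graph, of u] c c1 e1 g1 lam m(2) in simp_all)
qed

end
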